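(* Let $d\ge 2$, $p\ge 1$, let $C>0$ be admissible, and let $\mu,\nu\in\mathcal{P}_p(\mathbb{R}^d)$. Then: (a) $\mathrm{DSW}_p(\mu,\nu;C)\le \mathrm{maxSW}_p(\mu,\nu)\le W_p(\mu,\nu)$. (b) If $C\ge 1/d$, then $\mathrm{DSW}_p(\mu,\nu;C)\ge (1/d)^{1/p}\,\mathrm{maxSW}_p(\mu,\nu)\ge (1/d)^{1/p}\,\mathrm{SW}_p(\mu,\nu)$. As a consequence, when $p\ge1$ and $C\ge 1/d$, the metrics $\mathrm{DSW}_p(\cdot,\cdot;C)$, $\mathrm{SW}_p$, $\mathrm{maxSW}_p$ and $W_p$ are topologically equivalent on $\mathcal{P}_p(\mathbb{R}^d)$: for any sequence $(\mu_n)_{n\ge1}$ and $\mu$ in $\mathcal{P}_p(\mathbb{R}^d)$, convergence $\mu_n\to\mu$ under any one of these metrics implies convergence under each of the others.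
   Context: $\mathcal{P}_p(\mathbb{R}^d)$ is the set of Borel probability measures on $\mathbb{R}^d$ with finite $p$-th moment. $\mathbb{S}^{d-1}$ is the Euclidean unit sphere and $\sigma^{d-1}$ the uniform probability measure on it. For a probability measure $\mu$ on $\mathbb{R}^d$ and $\theta\in\mathbb{S}^{d-1}$, $\mathcal{R}\mu(\cdot,\theta)$ denotes the pushforward of $\mu$ under $x\mapsto\langle x,\theta\rangle$. $W_p$ is the Wasserstein distance of order $p$ with Euclidean ground cost. Define $\mathrm{SW}_p(\mu,\nu)=\big(\int_{\mathbb{S}^{d-1}}W_p^p(\mathcal{R}\mu(\cdot,\theta),\mathcal{R}\nu(\cdot,\theta))\,d\sigma^{d-1}(\theta)\big)^{1/p}$ and $\mathrm{maxSW}_p(\mu,\nu)=\max_{\theta\in\mathbb{S}^{d-1}}W_p(\mathcal{R}\mu(\cdot,\theta),\mathcal{R}\nu(\cdot,\theta))$. A constant $C>0$ is admissible if the set $\mathbb{M}_C$ of Borel probability measures $\sigma$ on $\mathbb{S}^{d-1}$ with $\mathbb{E}_{\theta,\theta'\sim\sigma}[|\theta^\top\theta'|]\le C$ ($\theta,\theta'$ independent) is nonempty, and then $\mathrm{DSW}_p(\mu,\nu;C)=\sup_{\sigma\in\mathbb{M}_C}\big(\mathbb{E}_{\theta\sim\sigma}[W_p^p(\mathcal{R}\mu(\cdot,\theta),\mathcal{R}\nu(\cdot,\theta))]\big)^{1/p}$. *)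

theory Defs
  imports "HOL-Probability.Probability"
begin

definition P_p :: "real \<Rightarrow> 'a::euclidean_space measure set" where
  "P_p p = {\<mu>. prob_space \<mu> \<and> sets \<mu> = sets borel \<and> integrable \<mu> (\<lambda>x. norm x powr p)}"

definition couplings :: "'a::euclidean_space measure \<Rightarrow> 'a measure \<Rightarrow> ('a \<times> 'a) measure set" where
  "couplings \<mu> \<nu> = {\<pi>. prob_space \<pi> \<and> sets \<pi> = sets (borel \<Otimes>\<^sub>M borel) \<and>
       distr \<pi> borel fst = \<mu> \<and> distr \<pi> borel snd = \<nu>}"

definition Wpp :: "real \<Rightarrow> 'a::euclidean_space measure \<Rightarrow> 'a measure \<Rightarrow> ennreal" where
  "Wpp p \<mu> \<nu> = (INF \<pi>\<in>couplings \<mu> \<nu>. \<integral>\<^sup>+ z. ennreal (dist (fst z) (snd z) powr p) \<partial>\<pi>)"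

definition Wasserstein :: "real \<Rightarrow> 'a::euclidean_space measure \<Rightarrow> 'a measure \<Rightarrow> real" where
  "Wasserstein p \<mu> \<nu> = enn2real (Wpp p \<mu> \<nu>) powr (1 / p)"

definition proj :: "'a::euclidean_space measure \<Rightarrow> 'a \<Rightarrow> real measure" where
  "proj \<mu> \<theta> = distr \<mu> borel (\<lambda>x. x \<bullet> \<theta>)"

definition sphere_unif :: "'a::euclidean_space measure" where
  "sphere_unif = distr (uniform_measure lborel (ball 0 1)) borel (\<lambda>x. x /\<^sub>R norm x)"

definition SW :: "real \<Rightarrow> 'a::euclidean_space measure \<Rightarrow> 'a measure \<Rightarrow> real" where
  "SW p \<mu> \<nu> = enn2real (\<integral>\<^sup>+ \<theta>. ennreal (Wasserstein p (proj \<mu> \<theta>) (proj \<nu> \<theta>) powr p) \<partial>sphere_unif)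
      powr (1 / p)"

definition maxSW :: "real \<Rightarrow> 'a::euclidean_space measure \<Rightarrow> 'a measure \<Rightarrow> real" where
  "maxSW p \<mu> \<nu> = (SUP \<theta>\<in>sphere 0 1. Wasserstein p (proj \<mu> \<theta>) (proj \<nu> \<theta>))"

definition MC :: "real \<Rightarrow> 'a::euclidean_space measure set" where
  "MC C = {\<sigma>. prob_space \<sigma> \<and> sets \<sigma> = sets borel \<and> emeasure \<sigma> (sphere 0 1) = 1 \<and>
      (\<integral>\<^sup>+ z. ennreal \<bar>fst z \<bullet> snd z\<bar> \<partial>(\<sigma> \<Otimes>\<^sub>M \<sigma>)) \<le> ennreal C}"

definition admissible :: "'a::euclidean_space itself \<Rightarrow> real \<Rightarrow> bool" where
  "admissible _ C \<longleftrightarrow> C > 0 \<and> (MC C :: 'a measure set) \<noteq> {}"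

definition DSW :: "real \<Rightarrow> real \<Rightarrow> 'a::euclidean_space measure \<Rightarrow> 'a measure \<Rightarrow> real" where
  "DSW p C \<mu> \<nu> = (SUP \<sigma>\<in>MC C.
      enn2real (\<integral>\<^sup>+ \<theta>. ennreal (Wasserstein p (proj \<mu> \<theta>) (proj \<nu> \<theta>) powr p) \<partial>\<sigma>) powr (1 / p))"

end

theory Submission
  imports Defs
begin

text \<open>Only the implication from convergence in \<open>SW\<close> to convergence in the Wasserstein distance is
  not elementary. The integrand of \<open>SW\<close> is only ever bounded from below by measurable functions of
  the direction, so its own measurability is never needed.

  Smooth \<open>\<mu>\<close> and \<open>\<nu>\<close> by a Gaussian of width \<open>e\<close>. Moving each point to its Gaussian perturbation,
  coupling the two smoothed densities on their common part, and moving back gives a coupling whose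
  cost is of order \<open>e powr p\<close>, plus the mass on which the smoothed densities differ times
  \<open>R powr p\<close>, plus the \<open>p\<close>-th moments outside the ball of radius \<open>R\<close>. The difference of the smoothed
  densities is a Gaussian average of differences of characteristic functions; along each ray these
  are bounded by the one-dimensional distance in that direction, so the average is controlled by
  \<open>SW\<close>. Averaging a one-dimensional duality bound over all directions controls the tail moments.\<close>

section \<open>Elementary comparisons\<close>

text \<open>A bound on \<open>SW\<close> controls the directions only on average. The nonnegative
  integral is monotone for arbitrary integrands but additive for measurable ones, so each estimate
  is first turned, direction by direction, into a measurable minorant of \<open>Wpp\<close> and only
  then integrated and split. Gaussians suit the smoothing for three reasons: they are strictly
  positive, so smoothed densities can be divided by; their moments scale like
  \<open>e powr p\<close>; and they are, up to scaling, their own Fourier transforms, which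
  expresses smoothed densities through cosines. Weak convergence alone does not control
  \<open>p\<close>-th moments. Uniformly small tails along the sequence are obtained by transferring
  the tail of the one limit measure through the directional bound, at the price of a larger radius
  and a constant factor. The error terms compete: the factor \<open>R powr p\<close> in front of the
  density mismatch grows with the radius, and the mismatch is harder to control for small
  \<open>e\<close>. Hence \<open>e\<close> and the radius are fixed first, from the limit measure
  alone, and the index of the sequence goes to infinity last.\<close>

lemma powr_add_le:
  fixes u v p :: real
  assumes "0 \<le> u" "0 \<le> v" "0 \<le> p"
  shows "(u + v) powr p \<le> 2 powr p * (u powr p + v powr p)"
proof -
  have "(u + v) powr p \<le> (2 * max u v) powr p"
    using assms by (intro powr_mono2) auto
  also have "\<dots> = 2 powr p * max u v powr p"
    using assms by (intro powr_mult)
  also have "max u v powr p \<le> u powr p + v powr p"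
    by (auto simp: max_def)
  finally show ?thesis by (simp add: mult_left_mono)
qed

lemma P_pD:
  assumes "\<mu> \<in> P_p p"
  shows "prob_space \<mu>" "sets \<mu> = sets borel" "space \<mu> = UNIV"
    "(\<integral>\<^sup>+ x. ennreal (norm x powr p) \<partial>\<mu>) < \<infinity>"
proof -
  show 1: "prob_space \<mu>" "sets \<mu> = sets borel"
    using assms by (auto simp: P_p_def)
  from sets_eq_imp_space_eq[OF 1(2)] show "space \<mu> = UNIV" by simp
  show "(\<integral>\<^sup>+ x. ennreal (norm x powr p) \<partial>\<mu>) < \<infinity>"
    using assms by (auto simp: P_p_def integrable_iff_bounded)
qed

lemma P_pI:
  fixes \<mu> :: "'a::euclidean_space measure"
  assumes "prob_space \<mu>" "sets \<mu> = sets borel" "(\<integral>\<^sup>+ x. ennreal (norm x powr p) \<partial>\<mu>) < \<infinity>"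
  shows "\<mu> \<in> P_p p"
proof -
  note [measurable_cong] = assms(2)
  show ?thesis using assms by (auto simp: P_p_def integrable_iff_bounded)
qed

lemma couplingsD:
  assumes "\<pi> \<in> couplings \<mu> \<nu>"
  shows "prob_space \<pi>" "sets \<pi> = sets (borel \<Otimes>\<^sub>M borel)"
    "distr \<pi> borel fst = \<mu>" "distr \<pi> borel snd = \<nu>"
  using assms by (auto simp: couplings_def)

lemma pair_measure_in_couplings:
  fixes \<mu> \<nu> :: "'a::euclidean_space measure"
  assumes \<mu>: "prob_space \<mu>" "sets \<mu> = sets borel" and \<nu>: "prob_space \<nu>" "sets \<nu> = sets borel"
  shows "\<mu> \<Otimes>\<^sub>M \<nu> \<in> couplings \<mu> \<nu>"
proof -
  interpret \<mu>: prob_space \<mu> by fact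
  interpret \<nu>: prob_space \<nu> by fact
  interpret pair_prob_space \<mu> \<nu> ..
  have "distr (\<mu> \<Otimes>\<^sub>M \<nu>) borel fst = distr (\<mu> \<Otimes>\<^sub>M \<nu>) \<mu> fst"
    by (rule distr_cong) (use \<mu> in auto)
  moreover have "distr (\<mu> \<Otimes>\<^sub>M \<nu>) borel snd = distr (\<mu> \<Otimes>\<^sub>M \<nu>) \<nu> snd"
    by (rule distr_cong) (use \<nu> in auto)
  moreover have "distr (\<mu> \<Otimes>\<^sub>M \<nu>) \<nu> snd = \<nu>"
  proof (rule measure_eqI)
    fix A assume "A \<in> sets (distr (\<mu> \<Otimes>\<^sub>M \<nu>) \<nu> snd)"
    then have A: "A \<in> sets \<nu>" by simp
    have "snd -` A \<inter> space (\<mu> \<Otimes>\<^sub>M \<nu>) = space \<mu> \<times> A"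
      using sets.sets_into_space[OF A] by (auto simp: space_pair_measure)
    then show "emeasure (distr (\<mu> \<Otimes>\<^sub>M \<nu>) \<nu> snd) A = emeasure \<nu> A"
      using A by (simp add: emeasure_distr \<nu>.emeasure_pair_measure_Times \<mu>.emeasure_space_1)
  qed simp
  ultimately show ?thesis
    unfolding couplings_def
    by (simp add: prob_space_axioms \<nu>.distr_pair_fst \<mu>.prob_space_axioms sets_pair_measure_cong[OF \<mu>(2) \<nu>(2)])
qed

text \<open>The independent coupling already has finite cost. Finiteness makes
  \<open>enn2real\<close> faithful in \<open>Wasserstein\<close>; an infinite infimum would be read
  as distance 0.\<close>

lemma Wpp_finite:
  fixes \<mu> \<nu> :: "'a::euclidean_space measure"
  assumes p: "0 \<le> p" and \<mu>: "\<mu> \<in> P_p p" and \<nu>: "\<nu> \<in> P_p p"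
  shows "Wpp p \<mu> \<nu> < \<infinity>"
proof -
  note m = P_pD[OF \<mu>] and n = P_pD[OF \<nu>]
  note [measurable_cong] = m(2) n(2)
  let ?\<pi> = "\<mu> \<Otimes>\<^sub>M \<nu>"
  have c: "?\<pi> \<in> couplings \<mu> \<nu>"
    by (rule pair_measure_in_couplings) fact+
  have "Wpp p \<mu> \<nu> \<le> (\<integral>\<^sup>+ z. ennreal (dist (fst z) (snd z) powr p) \<partial>?\<pi>)"
    unfolding Wpp_def by (rule INF_lower[OF c])
  also have "\<dots> \<le> (\<integral>\<^sup>+ z. ennreal (2 powr p) * (ennreal (norm (fst z) powr p) + ennreal (norm (snd z) powr p)) \<partial>?\<pi>)"
  proof (rule nn_integral_mono)
    fix z :: "'a \<times> 'a"
    have "dist (fst z) (snd z) powr p \<le> (norm (fst z) + norm (snd z)) powr p"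
      using p by (intro powr_mono2) (auto simp: dist_norm norm_triangle_ineq4)
    also have "\<dots> \<le> 2 powr p * (norm (fst z) powr p + norm (snd z) powr p)"
      by (rule powr_add_le) (use p in auto)
    finally show "ennreal (dist (fst z) (snd z) powr p)
        \<le> ennreal (2 powr p) * (ennreal (norm (fst z) powr p) + ennreal (norm (snd z) powr p))"
      by (simp add: ennreal_mult'[symmetric] ennreal_plus[symmetric] del: ennreal_plus)
  qed
  also have "\<dots> = ennreal (2 powr p) * ((\<integral>\<^sup>+ z. ennreal (norm (fst z) powr p) \<partial>?\<pi>) + (\<integral>\<^sup>+ z. ennreal (norm (snd z) powr p) \<partial>?\<pi>))"
    by (simp add: nn_integral_cmult nn_integral_add)
  also have "(\<integral>\<^sup>+ z. ennreal (norm (fst z) powr p) \<partial>?\<pi>) = (\<integral>\<^sup>+ x. ennreal (norm x powr p) \<partial>distr ?\<pi> borel fst)"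
    by (subst nn_integral_distr) auto
  also have "(\<integral>\<^sup>+ z. ennreal (norm (snd z) powr p) \<partial>?\<pi>) = (\<integral>\<^sup>+ x. ennreal (norm x powr p) \<partial>distr ?\<pi> borel snd)"
    by (subst nn_integral_distr) auto
  also have "ennreal (2 powr p) * ((\<integral>\<^sup>+ x. ennreal (norm x powr p) \<partial>distr ?\<pi> borel fst) + (\<integral>\<^sup>+ x. ennreal (norm x powr p) \<partial>distr ?\<pi> borel snd)) < \<infinity>"
    unfolding couplingsD(3,4)[OF c] using m(4) n(4) by (simp add: ennreal_mult_less_top)
  finally show ?thesis .
qed

lemma proj_in_P_p:
  fixes \<mu> :: "'a::euclidean_space measure"
  assumes p: "0 \<le> p" and \<mu>: "\<mu> \<in> P_p p"
  shows "proj \<mu> \<theta> \<in> P_p p"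
proof (rule P_pI)
  note m = P_pD[OF \<mu>]
  note [measurable_cong] = m(2)
  interpret prob_space \<mu> by fact
  show "prob_space (proj \<mu> \<theta>)" unfolding proj_def by (rule prob_space_distr) measurable
  have "(\<integral>\<^sup>+ x. ennreal (norm x powr p) \<partial>proj \<mu> \<theta>) = (\<integral>\<^sup>+ x. ennreal (\<bar>x \<bullet> \<theta>\<bar> powr p) \<partial>\<mu>)"
    unfolding proj_def by (subst nn_integral_distr) auto
  also have "\<dots> \<le> (\<integral>\<^sup>+ x. ennreal (norm \<theta> powr p) * ennreal (norm x powr p) \<partial>\<mu>)"
  proof (rule nn_integral_mono)
    fix x
    have "\<bar>x \<bullet> \<theta>\<bar> powr p \<le> (norm \<theta> * norm x) powr p"
      using p Cauchy_Schwarz_ineq2[of x \<theta>] by (intro powr_mono2) (auto simp: mult.commute)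
    then show "ennreal (\<bar>x \<bullet> \<theta>\<bar> powr p) \<le> ennreal (norm \<theta> powr p) * ennreal (norm x powr p)"
      by (simp add: ennreal_mult'[symmetric] powr_mult)
  qed
  also have "\<dots> = ennreal (norm \<theta> powr p) * (\<integral>\<^sup>+ x. ennreal (norm x powr p) \<partial>\<mu>)"
    by (rule nn_integral_cmult) measurable
  also have "\<dots> < \<infinity>" using m(4) by (simp add: ennreal_mult_less_top)
  finally show "(\<integral>\<^sup>+ x. ennreal (norm x powr p) \<partial>proj \<mu> \<theta>) < \<infinity>" .
qed (simp add: proj_def)

text \<open>Projecting both coordinates of a coupling by \<open>T\<close> couples the projections,
  and by Cauchy-Schwarz this does not increase distances.\<close>

lemma Wpp_proj_le:
  fixes \<mu> \<nu> :: "'a::euclidean_space measure"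
  assumes p: "0 \<le> p" and \<theta>: "norm \<theta> \<le> 1"
  shows "Wpp p (proj \<mu> \<theta>) (proj \<nu> \<theta>) \<le> Wpp p \<mu> \<nu>"
  unfolding Wpp_def[of p \<mu>]
proof (rule INF_greatest)
  fix \<pi> assume \<pi>: "\<pi> \<in> couplings \<mu> \<nu>"
  note P = couplingsD[OF \<pi>]
  note [measurable_cong] = P(2)
  interpret prob_space \<pi> by fact
  define T :: "'a \<times> 'a \<Rightarrow> real \<times> real" where "T z = (fst z \<bullet> \<theta>, snd z \<bullet> \<theta>)" for z
  have T[measurable]: "T \<in> \<pi> \<rightarrow>\<^sub>M borel \<Otimes>\<^sub>M borel"
    unfolding T_def by measurable
  have "distr \<pi> (borel \<Otimes>\<^sub>M borel) T \<in> couplings (proj \<mu> \<theta>) (proj \<nu> \<theta>)"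
    unfolding couplings_def proj_def P(3,4)[symmetric]
    by (auto simp: distr_distr o_def T_def intro!: prob_space_distr)
  then have "Wpp p (proj \<mu> \<theta>) (proj \<nu> \<theta>) \<le> (\<integral>\<^sup>+ z. ennreal (dist (fst z) (snd z) powr p) \<partial>distr \<pi> (borel \<Otimes>\<^sub>M borel) T)"
    unfolding Wpp_def by (rule INF_lower)
  also have "\<dots> = (\<integral>\<^sup>+ z. ennreal (dist (fst z \<bullet> \<theta>) (snd z \<bullet> \<theta>) powr p) \<partial>\<pi>)"
    by (subst nn_integral_distr) (auto simp: T_def)
  also have "\<dots> \<le> (\<integral>\<^sup>+ z. ennreal (dist (fst z) (snd z) powr p) \<partial>\<pi>)"
  proof (rule nn_integral_mono, rule ennreal_leI, rule powr_mono2)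
    fix z :: "'a \<times> 'a"
    have "\<bar>(fst z - snd z) \<bullet> \<theta>\<bar> \<le> norm (fst z - snd z) * norm \<theta>"
      by (rule Cauchy_Schwarz_ineq2)
    also have "\<dots> \<le> norm (fst z - snd z)"
      using \<theta> by (intro mult_left_le) auto
    finally show "dist (fst z \<bullet> \<theta>) (snd z \<bullet> \<theta>) \<le> dist (fst z) (snd z)"
      by (simp add: dist_norm inner_diff_left)
  qed (use p in auto)
  finally show "Wpp p (proj \<mu> \<theta>) (proj \<nu> \<theta>) \<le> (\<integral>\<^sup>+ z. ennreal (dist (fst z) (snd z) powr p) \<partial>\<pi>)" .
qed

lemma Wasserstein_nonneg: "0 \<le> Wasserstein p \<mu> \<nu>"
  by (simp add: Wasserstein_def)

lemma ennreal_Wasserstein_powr: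
  fixes \<mu> \<nu> :: "'a::euclidean_space measure"
  assumes p: "0 < p" and \<mu>: "\<mu> \<in> P_p p" and \<nu>: "\<nu> \<in> P_p p"
  shows "ennreal (Wasserstein p \<mu> \<nu> powr p) = Wpp p \<mu> \<nu>"
  using p Wpp_finite[OF _ \<mu> \<nu>] by (simp add: Wasserstein_def powr_powr)

lemma Wasserstein_proj_le:
  fixes \<mu> \<nu> :: "'a::euclidean_space measure"
  assumes p: "0 < p" and \<mu>: "\<mu> \<in> P_p p" and \<nu>: "\<nu> \<in> P_p p" and \<theta>: "norm \<theta> \<le> 1"
  shows "Wasserstein p (proj \<mu> \<theta>) (proj \<nu> \<theta>) \<le> Wasserstein p \<mu> \<nu>"
  unfolding Wasserstein_def
  using p Wpp_finite[OF _ \<mu> \<nu>] Wpp_proj_le[OF _ \<theta>, of p \<mu> \<nu>]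
  by (intro powr_mono2 enn2real_mono) auto

text \<open>A supremum of reals is informative only over a bounded set; the bound is
  \<open>Wasserstein p \<mu> \<nu>\<close>, uniformly in the direction.\<close>

lemma bdd_above_Wasserstein_proj:
  fixes \<mu> \<nu> :: "'a::euclidean_space measure"
  assumes p: "0 < p" and \<mu>: "\<mu> \<in> P_p p" and \<nu>: "\<nu> \<in> P_p p"
  shows "bdd_above ((\<lambda>\<theta>. Wasserstein p (proj \<mu> \<theta>) (proj \<nu> \<theta>)) ` sphere 0 1)"
  using Wasserstein_proj_le[OF assms] by (auto intro!: bdd_aboveI2[where M="Wasserstein p \<mu> \<nu>"])

lemma sphere_0_1_nonempty: "sphere (0::'a::euclidean_space) 1 \<noteq> {}"
  using SOME_Basis by (metis empty_iff mem_sphere_0 norm_Basis)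

lemma maxSW_le_Wasserstein:
  fixes \<mu> \<nu> :: "'a::euclidean_space measure"
  assumes p: "0 < p" and \<mu>: "\<mu> \<in> P_p p" and \<nu>: "\<nu> \<in> P_p p"
  shows "maxSW p \<mu> \<nu> \<le> Wasserstein p \<mu> \<nu>"
  unfolding maxSW_def
  by (rule cSUP_least[OF sphere_0_1_nonempty]) (use Wasserstein_proj_le[OF assms] in auto)

lemma Wasserstein_proj_le_maxSW:
  fixes \<mu> \<nu> :: "'a::euclidean_space measure"
  assumes p: "0 < p" and \<mu>: "\<mu> \<in> P_p p" and \<nu>: "\<nu> \<in> P_p p" and \<theta>: "\<theta> \<in> sphere 0 1"
  shows "Wasserstein p (proj \<mu> \<theta>) (proj \<nu> \<theta>) \<le> maxSW p \<mu> \<nu>"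
  unfolding maxSW_def
  by (rule cSUP_upper[OF \<theta> bdd_above_Wasserstein_proj[OF p \<mu> \<nu>]])

lemma maxSW_nonneg:
  fixes \<mu> \<nu> :: "'a::euclidean_space measure"
  assumes p: "0 < p" and \<mu>: "\<mu> \<in> P_p p" and \<nu>: "\<nu> \<in> P_p p"
  shows "0 \<le> maxSW p \<mu> \<nu>"
  using sphere_0_1_nonempty[where 'a='a] Wasserstein_proj_le_maxSW[OF assms] Wasserstein_nonneg order_trans
  by blast

text \<open>Bounding the integrand by a constant uses only monotonicity of the integral. The
  resulting finiteness is also what allows \<open>enn2real\<close> to be undone in \<open>SW\<close>
  and compared in \<open>DSW\<close>.\<close>

lemma nn_integral_Wasserstein_proj_le:
  fixes \<mu> \<nu> \<sigma> :: "'a::euclidean_space measure"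
  assumes p: "0 < p" and \<mu>: "\<mu> \<in> P_p p" and \<nu>: "\<nu> \<in> P_p p"
    and \<sigma>: "prob_space \<sigma>" "AE \<theta> in \<sigma>. \<theta> \<in> sphere 0 1"
  shows "(\<integral>\<^sup>+ \<theta>. ennreal (Wasserstein p (proj \<mu> \<theta>) (proj \<nu> \<theta>) powr p) \<partial>\<sigma>) \<le> ennreal (maxSW p \<mu> \<nu> powr p)"
proof -
  interpret prob_space \<sigma> by fact
  have "(\<integral>\<^sup>+ \<theta>. ennreal (Wasserstein p (proj \<mu> \<theta>) (proj \<nu> \<theta>) powr p) \<partial>\<sigma>)
      \<le> (\<integral>\<^sup>+ \<theta>. ennreal (maxSW p \<mu> \<nu> powr p) \<partial>\<sigma>)"
    by (rule nn_integral_mono_AE, rule AE_mp[OF \<sigma>(2)])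
      (use p Wasserstein_proj_le_maxSW[OF p \<mu> \<nu>] in
        \<open>auto intro!: ennreal_leI powr_mono2 simp: Wasserstein_nonneg\<close>)
  also have "\<dots> = ennreal (maxSW p \<mu> \<nu> powr p)" by (simp add: emeasure_space_1)
  finally show ?thesis .
qed

lemma powr_nn_integral_Wasserstein_proj_le:
  fixes \<mu> \<nu> \<sigma> :: "'a::euclidean_space measure"
  assumes p: "0 < p" and \<mu>: "\<mu> \<in> P_p p" and \<nu>: "\<nu> \<in> P_p p"
    and \<sigma>: "prob_space \<sigma>" "AE \<theta> in \<sigma>. \<theta> \<in> sphere 0 1"
  shows "enn2real (\<integral>\<^sup>+ \<theta>. ennreal (Wasserstein p (proj \<mu> \<theta>) (proj \<nu> \<theta>) powr p) \<partial>\<sigma>) powr (1 / p) \<le> maxSW p \<mu> \<nu>"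
    (is "?I powr _ \<le> _")
proof -
  have "?I \<le> maxSW p \<mu> \<nu> powr p"
    using enn2real_mono[OF nn_integral_Wasserstein_proj_le[OF assms]] by simp
  then have "?I powr (1 / p) \<le> (maxSW p \<mu> \<nu> powr p) powr (1 / p)"
    using p by (intro powr_mono2) auto
  also have "\<dots> = maxSW p \<mu> \<nu>"
    using p maxSW_nonneg[OF p \<mu> \<nu>] by (simp add: powr_powr)
  finally show ?thesis .
qed

lemma MCD:
  assumes "\<sigma> \<in> MC C"
  shows "prob_space \<sigma>" "AE \<theta> in \<sigma>. \<theta> \<in> sphere 0 1"
proof -
  show "prob_space \<sigma>" using assms by (simp add: MC_def)
  then interpret prob_space \<sigma> .
  have "sphere 0 1 \<in> sets \<sigma>" "emeasure \<sigma> (sphere 0 1) = 1"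
    using assms by (auto simp: MC_def)
  then show "AE \<theta> in \<sigma>. \<theta> \<in> sphere 0 1"
    by (subst AE_in_set_eq_1) (auto simp: emeasure_eq_measure)
qed

lemma DSW_le_maxSW:
  fixes \<mu> \<nu> :: "'a::euclidean_space measure"
  assumes p: "0 < p" and \<mu>: "\<mu> \<in> P_p p" and \<nu>: "\<nu> \<in> P_p p" and C: "admissible TYPE('a) C"
  shows "DSW p C \<mu> \<nu> \<le> maxSW p \<mu> \<nu>"
  unfolding DSW_def
  using C powr_nn_integral_Wasserstein_proj_le[OF p \<mu> \<nu> MCD]
  by (intro cSUP_least) (auto simp: admissible_def)

section \<open>The uniform law on directions\<close>

lemma prob_space_uniform_ball: "prob_space (uniform_measure lborel (ball (0::'a::euclidean_space) 1))"
proof (rule prob_space_uniform_measure)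
  show "emeasure lborel (ball (0::'a) 1) \<noteq> 0"
    using unit_ball_vol_pos[of "real DIM('a)"] by (simp add: emeasure_ball del: unit_ball_vol_pos)
  show "emeasure lborel (ball (0::'a) 1) \<noteq> \<infinity>"
    using emeasure_lborel_ball_finite[of "0::'a" 1] by auto
qed

text \<open>At the origin the normalization \<open>x /\<^sub>R norm x\<close> returns 0, which is
  off the sphere; the origin is a Lebesgue null set.\<close>

lemma AE_uniform_ball_neq_0: "AE x in uniform_measure lborel (ball (0::'a::euclidean_space) 1). x \<noteq> 0"
  using AE_lborel_singleton[of "0::'a"] by (auto intro: AE_uniform_measureI)

lemma prob_space_sphere_unif: "prob_space (sphere_unif :: 'a::euclidean_space measure)"
  unfolding sphere_unif_def
  by (rule prob_space.prob_space_distr[OF prob_space_uniform_ball]) simp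

lemma AE_sphere_unif: "AE \<theta> in (sphere_unif :: 'a::euclidean_space measure). \<theta> \<in> sphere 0 1"
  unfolding sphere_unif_def
  by (subst AE_distr_iff) (use AE_uniform_ball_neq_0 in auto)

lemma SW_le_maxSW:
  fixes \<mu> \<nu> :: "'a::euclidean_space measure"
  assumes p: "0 < p" and \<mu>: "\<mu> \<in> P_p p" and \<nu>: "\<nu> \<in> P_p p"
  shows "SW p \<mu> \<nu> \<le> maxSW p \<mu> \<nu>"
  unfolding SW_def
  by (rule powr_nn_integral_Wasserstein_proj_le[OF p \<mu> \<nu> prob_space_sphere_unif AE_sphere_unif])

text \<open>Complete \<open>\<theta>\<close> to an orthonormal basis and take the uniform law on it.
  Two independent draws agree with probability 1/d, contributing 1, and are otherwise orthogonal,
  contributing 0. The expectation is thus exactly 1/d, which is where the threshold on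
  \<open>C\<close> comes from.\<close>

lemma exists_MC_atom:
  fixes \<theta> :: "'a::euclidean_space"
  assumes \<theta>: "\<theta> \<in> sphere 0 1" and C: "C \<ge> 1 / real DIM('a)"
  shows "\<exists>\<sigma>\<in>MC C. emeasure \<sigma> {\<theta>} = ennreal (1 / real DIM('a))"
proof -
  have "norm \<theta> = 1" using \<theta> by simp
  obtain S :: "'a set" where S: "\<theta> \<in> S" "pairwise orthogonal S" "\<And>x. x \<in> S \<Longrightarrow> norm x = 1"
    "independent S" "card S = DIM('a)" "span S = UNIV"
    by (rule vector_in_orthonormal_basis[OF \<open>norm \<theta> = 1\<close>]) (rule that)
  have [simp]: "S \<noteq> {}" using S(1) by blast
  have [simp]: "finite S" by (rule independent_imp_finite[OF S(4)])
  \<comment> \<open>The measure of a pmf lives on all subsets; the identity map transports it to the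
    Borel sets that \<open>MC\<close> asks for.\<close>
  define \<sigma> where "\<sigma> = distr (measure_pmf (pmf_of_set S)) borel (\<lambda>x. x)"
  have [measurable_cong]: "sets \<sigma> = sets borel" by (simp add: \<sigma>_def)
  interpret S: prob_space \<sigma>
    unfolding \<sigma>_def by (rule prob_space.prob_space_distr[OF measure_pmf.prob_space_axioms]) simp
  have div: "1 / ennreal (real DIM('a)) = ennreal (1 / real DIM('a))"
    by (metis divide_ennreal DIM_positive ennreal_1 of_nat_0_less_iff zero_le_one)
  have int: "(\<integral>\<^sup>+ x. f x \<partial>\<sigma>) = sum f S / ennreal (real DIM('a))" if [measurable]: "f \<in> borel_measurable borel" for f
  proof -
    have "(\<integral>\<^sup>+ x. f x \<partial>\<sigma>) = (\<integral>\<^sup>+ x. f x \<partial>measure_pmf (pmf_of_set S))"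
      unfolding \<sigma>_def by (rule nn_integral_distr) simp_all
    also have "\<dots> = sum f S / of_nat (card S)"
      by (rule nn_integral_pmf_of_set) simp_all
    finally show ?thesis unfolding S(5) ennreal_of_nat_eq_real_of_nat .
  qed
  have em: "emeasure \<sigma> A = ennreal (real (card (S \<inter> A)) / real DIM('a))" if "A \<in> sets borel" for A
    unfolding \<sigma>_def using that
    by (simp add: emeasure_distr emeasure_pmf_of_set S(5))
  have "(\<integral>\<^sup>+ z. ennreal \<bar>fst z \<bullet> snd z\<bar> \<partial>(\<sigma> \<Otimes>\<^sub>M \<sigma>)) = (\<integral>\<^sup>+ x. \<integral>\<^sup>+ y. ennreal \<bar>x \<bullet> y\<bar> \<partial>\<sigma> \<partial>\<sigma>)"
    by (subst S.nn_integral_fst[symmetric]) auto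
  also have "\<dots> = (\<Sum>x\<in>S. (\<Sum>y\<in>S. ennreal \<bar>x \<bullet> y\<bar>) / ennreal (real DIM('a))) / ennreal (real DIM('a))"
    by (subst int, simp) (simp add: int)
  also have "(\<Sum>x\<in>S. (\<Sum>y\<in>S. ennreal \<bar>x \<bullet> y\<bar>) / ennreal (real DIM('a))) = (\<Sum>x\<in>S. ennreal (1 / real DIM('a)))"
  proof (rule sum.cong)
    fix x assume x: "x \<in> S"
    have "(\<Sum>y\<in>S. ennreal \<bar>x \<bullet> y\<bar>) = (\<Sum>y\<in>S. if y = x then 1 else 0)"
      using x S(2) S(3)[OF x] by (intro sum.cong) (auto simp: pairwise_def orthogonal_def dot_square_norm)
    also have "\<dots> = 1" using x by simp
    finally show "(\<Sum>y\<in>S. ennreal \<bar>x \<bullet> y\<bar>) / ennreal (real DIM('a)) = ennreal (1 / real DIM('a))"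
      by (simp only: div)
  qed simp
  also have "\<dots> / ennreal (real DIM('a)) = ennreal (1 / real DIM('a))"
    using S(5) div by (simp add: ennreal_of_nat_eq_real_of_nat ennreal_mult'[symmetric])
  also have "\<dots> \<le> ennreal C" using C by (rule ennreal_leI)
  finally have "\<sigma> \<in> MC C"
  proof -
    assume *: "(\<integral>\<^sup>+ z. ennreal \<bar>fst z \<bullet> snd z\<bar> \<partial>(\<sigma> \<Otimes>\<^sub>M \<sigma>)) \<le> ennreal C"
    have "S \<inter> sphere 0 1 = S" using S(3) by auto
    then show ?thesis
      using * S(5) by (simp add: MC_def S.prob_space_axioms em \<open>sets \<sigma> = sets borel\<close>)
  qed
  moreover have "emeasure \<sigma> {\<theta>} = ennreal (1 / real DIM('a))"
    using S(1) by (simp add: em)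
  ultimately show ?thesis by blast
qed

text \<open>Against a measure with an atom of mass 1/d at \<open>\<theta>\<close> the integral is at
  least 1/d times the integrand at \<open>\<theta>\<close>; the \<open>p\<close>-th root turns 1/d
  into the stated factor. The supremum over \<open>\<theta>\<close> is taken at the end.\<close>

lemma maxSW_le_DSW:
  fixes \<mu> \<nu> :: "'a::euclidean_space measure"
  assumes p: "0 < p" and \<mu>: "\<mu> \<in> P_p p" and \<nu>: "\<nu> \<in> P_p p" and C: "C \<ge> 1 / real DIM('a)"
  shows "(1 / real DIM('a)) powr (1 / p) * maxSW p \<mu> \<nu> \<le> DSW p C \<mu> \<nu>"
proof -
  let ?W = "\<lambda>\<theta>. Wasserstein p (proj \<mu> \<theta>) (proj \<nu> \<theta>)"
  let ?c = "(1 / real DIM('a)) powr (1 / p)"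
  have "?c * ?W \<theta> \<le> DSW p C \<mu> \<nu>" if \<theta>: "\<theta> \<in> sphere 0 1" for \<theta>
  proof -
    obtain \<sigma> where \<sigma>: "\<sigma> \<in> MC C" and at: "emeasure \<sigma> {\<theta>} = ennreal (1 / real DIM('a))"
      using exists_MC_atom[OF \<theta> C] by blast
    let ?I = "\<integral>\<^sup>+ \<theta>. ennreal (?W \<theta> powr p) \<partial>\<sigma>"
    have s: "{\<theta>} \<in> sets \<sigma>" using \<sigma> by (simp add: MC_def)
    \<comment> \<open>The atom enters through a measurable minorant, a constant times the indicator
      of the single point \<open>\<theta>\<close>.\<close>
    have "(\<integral>\<^sup>+ x. ennreal (?W \<theta> powr p) * indicator {\<theta>} x \<partial>\<sigma>) \<le> ?I"
      by (rule nn_integral_mono) (auto split: split_indicator)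
    then have "ennreal (?W \<theta> powr p * (1 / real DIM('a))) \<le> ?I"
      using s by (simp add: nn_integral_cmult_indicator at ennreal_mult'[symmetric])
    moreover have fin: "?I < top"
      using nn_integral_Wasserstein_proj_le[OF p \<mu> \<nu> MCD[OF \<sigma>]] by (simp add: order_le_less_trans)
    ultimately have "enn2real (ennreal (?W \<theta> powr p * (1 / real DIM('a)))) \<le> enn2real ?I"
      by (intro enn2real_mono)
    then have "(?W \<theta> powr p * (1 / real DIM('a))) powr (1 / p) \<le> enn2real ?I powr (1 / p)"
      using p by (intro powr_mono2) auto
    moreover have "(?W \<theta> powr p * (1 / real DIM('a))) powr (1 / p) = ?c * ?W \<theta>"
      using p powr_mult[of "?W \<theta> powr p" "1 / real DIM('a)" "1 / p"]
      by (simp add: powr_powr Wasserstein_nonneg mult.commute)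
    \<comment> \<open>Comparison with the supremum needs a bound over all of \<open>MC C\<close>;
      \<open>maxSW\<close> provides one.\<close>
    moreover have "enn2real ?I powr (1 / p) \<le> DSW p C \<mu> \<nu>"
      unfolding DSW_def
      by (rule cSUP_upper[OF \<sigma>])
        (use powr_nn_integral_Wasserstein_proj_le[OF p \<mu> \<nu> MCD] in \<open>auto intro!: bdd_aboveI2\<close>)
    ultimately show ?thesis by simp
  qed
  then have "maxSW p \<mu> \<nu> \<le> DSW p C \<mu> \<nu> / ?c"
    unfolding maxSW_def
    by (intro cSUP_least[OF sphere_0_1_nonempty]) (simp add: pos_le_divide_eq mult.commute)
  then show ?thesis by (simp add: pos_le_divide_eq mult.commute)
qed

section \<open>Couplings obtained by smoothing\<close>

text \<open>The marginal conditions are stated almost everywhere because, when the partial coupling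
  below already covers all mass, the defects vanish only up to null sets.\<close>

lemma density_in_couplings:
  fixes \<mu> \<nu> :: "'a::euclidean_space measure" and K :: "'a \<Rightarrow> 'a \<Rightarrow> ennreal"
  assumes \<mu>: "prob_space \<mu>" "sets \<mu> = sets borel" and \<nu>: "prob_space \<nu>" "sets \<nu> = sets borel"
    and K[measurable]: "case_prod K \<in> borel_measurable (borel \<Otimes>\<^sub>M borel)"
    and 1: "AE x in \<mu>. (\<integral>\<^sup>+ y. K x y \<partial>\<nu>) = 1" and 2: "AE y in \<nu>. (\<integral>\<^sup>+ x. K x y \<partial>\<mu>) = 1"
  shows "density (\<mu> \<Otimes>\<^sub>M \<nu>) (case_prod K) \<in> couplings \<mu> \<nu>"
proof -
  note [measurable_cong] = \<mu>(2) \<nu>(2)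
  interpret \<mu>: prob_space \<mu> by fact
  interpret \<nu>: prob_space \<nu> by fact
  interpret pair_prob_space \<mu> \<nu> ..
  let ?\<pi> = "density (\<mu> \<Otimes>\<^sub>M \<nu>) (case_prod K)"
  have s: "space \<mu> = UNIV" "space \<nu> = UNIV"
    using sets_eq_imp_space_eq[OF \<mu>(2)] sets_eq_imp_space_eq[OF \<nu>(2)] by auto
  have d1: "distr ?\<pi> borel fst = \<mu>"
  proof (rule measure_eqI)
    fix A assume "A \<in> sets (distr ?\<pi> borel fst)"
    then have A[measurable]: "A \<in> sets borel" by simp
    have "emeasure (distr ?\<pi> borel fst) A = (\<integral>\<^sup>+ z. indicator A z \<partial>distr ?\<pi> borel fst)" by simp
    also have "\<dots> = (\<integral>\<^sup>+ z. case_prod K z * indicator A (fst z) \<partial>(\<mu> \<Otimes>\<^sub>M \<nu>))"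
      by (simp add: nn_integral_distr nn_integral_density del: nn_integral_indicator)
    also have "\<dots> = (\<integral>\<^sup>+ x. \<integral>\<^sup>+ y. K x y * indicator A x \<partial>\<nu> \<partial>\<mu>)"
      by (subst \<nu>.nn_integral_fst[symmetric]) auto
    also have "\<dots> = (\<integral>\<^sup>+ x. (\<integral>\<^sup>+ y. K x y \<partial>\<nu>) * indicator A x \<partial>\<mu>)"
      by (intro nn_integral_cong nn_integral_multc) simp
    also have "\<dots> = (\<integral>\<^sup>+ x. indicator A x \<partial>\<mu>)"
      by (rule nn_integral_cong_AE) (use 1 in auto)
    finally show "emeasure (distr ?\<pi> borel fst) A = emeasure \<mu> A" using \<mu>(2) by simp
  qed (simp add: \<mu>(2))
  have d2: "distr ?\<pi> borel snd = \<nu>"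
  proof (rule measure_eqI)
    fix A assume "A \<in> sets (distr ?\<pi> borel snd)"
    then have A[measurable]: "A \<in> sets borel" by simp
    have "emeasure (distr ?\<pi> borel snd) A = (\<integral>\<^sup>+ z. indicator A z \<partial>distr ?\<pi> borel snd)" by simp
    also have "\<dots> = (\<integral>\<^sup>+ z. case_prod K z * indicator A (snd z) \<partial>(\<mu> \<Otimes>\<^sub>M \<nu>))"
      by (simp add: nn_integral_distr nn_integral_density del: nn_integral_indicator)
    also have "\<dots> = (\<integral>\<^sup>+ y. \<integral>\<^sup>+ x. K x y * indicator A y \<partial>\<mu> \<partial>\<nu>)"
      by (subst nn_integral_snd[symmetric]) (auto simp: case_prod_beta')
    also have "\<dots> = (\<integral>\<^sup>+ y. (\<integral>\<^sup>+ x. K x y \<partial>\<mu>) * indicator A y \<partial>\<nu>)"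
      by (intro nn_integral_cong nn_integral_multc) simp
    also have "\<dots> = (\<integral>\<^sup>+ y. indicator A y \<partial>\<nu>)"
      by (rule nn_integral_cong_AE) (use 2 in auto)
    finally show "emeasure (distr ?\<pi> borel snd) A = emeasure \<nu> A" using \<nu>(2) by simp
  qed (simp add: \<nu>(2))
  \<comment> \<open>The total mass of the density is read off from its first marginal.\<close>
  have "prob_space (distr ?\<pi> borel fst)" unfolding d1 by fact
  then have "prob_space ?\<pi>"
    by (intro prob_spaceI) (auto dest!: prob_space.emeasure_space_1 simp: emeasure_distr s space_pair_measure)
  then show ?thesis
    unfolding couplings_def using d1 d2
    by (simp add: sets_pair_measure_cong[OF \<mu>(2) \<nu>(2)])
qed

text \<open>A partial coupling with density \<^term>\<open>k\<close> is completed by coupling the uncovered mass independently.\<close>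

lemma Wpp_le_partial_coupling:
  fixes \<mu> \<nu> :: "'a::euclidean_space measure" and k :: "'a \<Rightarrow> 'a \<Rightarrow> ennreal"
  assumes \<mu>: "prob_space \<mu>" "sets \<mu> = sets borel" and \<nu>: "prob_space \<nu>" "sets \<nu> = sets borel"
    and p: "0 \<le> p"
    and k[measurable]: "case_prod k \<in> borel_measurable (borel \<Otimes>\<^sub>M borel)"
    and F: "\<And>x. (\<integral>\<^sup>+ y. k x y \<partial>\<nu>) = F x" "\<And>x. F x \<le> 1"
    and G: "\<And>y. (\<integral>\<^sup>+ x. k x y \<partial>\<mu>) = G y" "\<And>y. G y \<le> 1"
  shows "Wpp p \<mu> \<nu> \<le> (\<integral>\<^sup>+ x. \<integral>\<^sup>+ y. k x y * ennreal (dist x y powr p) \<partial>\<nu> \<partial>\<mu>)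
    + ennreal (2 powr p) * ((\<integral>\<^sup>+ x. (1 - F x) * ennreal (norm x powr p) \<partial>\<mu>)
        + (\<integral>\<^sup>+ y. (1 - G y) * ennreal (norm y powr p) \<partial>\<nu>))"
proof -
  note [measurable_cong] = \<mu>(2) \<nu>(2)
  interpret \<mu>: prob_space \<mu> by fact
  interpret \<nu>: prob_space \<nu> by fact
  interpret pair_prob_space \<mu> \<nu> ..
  have F': "F = (\<lambda>x. \<integral>\<^sup>+ y. k x y \<partial>\<nu>)" and G': "G = (\<lambda>y. \<integral>\<^sup>+ x. k x y \<partial>\<mu>)"
    using F(1) G(1) by auto
  have mF[measurable]: "F \<in> borel_measurable borel" unfolding F' by measurable
  have mG[measurable]: "G \<in> borel_measurable borel" unfolding G' by measurable
  have FG: "(\<integral>\<^sup>+ x. F x \<partial>\<mu>) = (\<integral>\<^sup>+ y. G y \<partial>\<nu>)"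
    unfolding F' G' by (rule Fubini'[symmetric]) measurable
  have F1: "(\<integral>\<^sup>+ x. F x \<partial>\<mu>) \<le> 1"
    using nn_integral_mono[of \<mu> F "\<lambda>_. 1"] F(2) by (simp add: \<mu>.emeasure_space_1)
  \<comment> \<open>The uncovered mass. It is the same on both sides, since the two marginals of
    \<open>k\<close> have equal total mass.\<close>
  define s where "s = (\<integral>\<^sup>+ x. 1 - F x \<partial>\<mu>)"
  have fin: "(\<integral>\<^sup>+ x. F x \<partial>\<mu>) \<noteq> \<infinity>" using F1 by (auto simp: top_unique)
  have s1: "s = 1 - (\<integral>\<^sup>+ x. F x \<partial>\<mu>)"
    unfolding s_def using fin F(2) by (subst nn_integral_diff) (auto simp: \<mu>.emeasure_space_1)
  have s2: "(\<integral>\<^sup>+ y. 1 - G y \<partial>\<nu>) = s"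
    unfolding s1 FG using fin G(2) by (subst nn_integral_diff) (auto simp: \<nu>.emeasure_space_1 FG)
  have s_fin: "s < \<infinity>" unfolding s1 by (simp add: diff_less_top_ennreal)
  \<comment> \<open>The second summand couples the defects \<open>1 - F\<close> and
    \<open>1 - G\<close> independently; each has mass \<open>s\<close>, whence the normalization.
    For \<open>s = 0\<close> the quotient \<open>s / s\<close> is 0, and the marginals are correct
    because the defects vanish almost everywhere.\<close>
  define K where "K x y = k x y + (1 - F x) * (1 - G y) / s" for x y
  have mK[measurable]: "case_prod K \<in> borel_measurable (borel \<Otimes>\<^sub>M borel)"
    unfolding K_def by measurable
  have ss: "s / s = 1" if "s \<noteq> 0" using that s_fin by (simp add: ennreal_divide_self)
  have intK1: "(\<integral>\<^sup>+ y. K x y \<partial>\<nu>) = F x + (1 - F x) * (s / s)" for x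
    unfolding K_def
    by (simp add: nn_integral_add nn_integral_divide nn_integral_cmult F(1) s2 ennreal_times_divide)
  have intK2: "(\<integral>\<^sup>+ x. K x y \<partial>\<mu>) = G y + (1 - G y) * (s / s)" for y
    unfolding K_def
    by (simp add: nn_integral_add nn_integral_divide nn_integral_multc G(1) s_def[symmetric])
      (simp add: divide_ennreal_def ac_simps)
  have c: "density (\<mu> \<Otimes>\<^sub>M \<nu>) (case_prod K) \<in> couplings \<mu> \<nu>"
  proof (rule density_in_couplings[OF \<mu> \<nu> mK])
    show "AE x in \<mu>. (\<integral>\<^sup>+ y. K x y \<partial>\<nu>) = 1"
    proof (cases "s = 0")
      case True
      then have "AE x in \<mu>. 1 - F x = 0"
        unfolding s_def by (subst (asm) nn_integral_0_iff_AE) auto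
      then show ?thesis
        by eventually_elim (metis F(2) intK1 add_diff_inverse_ennreal add_0_right mult_zero_left)
    next
      case False
      then show ?thesis using F(2) by (simp add: intK1 ss add_diff_inverse_ennreal)
    qed
    show "AE y in \<nu>. (\<integral>\<^sup>+ x. K x y \<partial>\<mu>) = 1"
    proof (cases "s = 0")
      case True
      then have "AE y in \<nu>. 1 - G y = 0"
        unfolding s2[symmetric] by (subst (asm) nn_integral_0_iff_AE) auto
      then show ?thesis
        by eventually_elim (metis G(2) intK2 add_diff_inverse_ennreal add_0_right mult_zero_left)
    next
      case False
      then show ?thesis using G(2) by (simp add: intK2 ss add_diff_inverse_ennreal)
    qed
  qed
  \<comment> \<open>Only an inequality: the left side is 0 when \<open>s = 0\<close>.\<close>
  have ss1: "u * s / s \<le> u" for u :: ennreal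
    using ss by (cases "s = 0") (auto simp: ennreal_times_divide[symmetric])
  have "Wpp p \<mu> \<nu> \<le> (\<integral>\<^sup>+ z. ennreal (dist (fst z) (snd z) powr p) \<partial>density (\<mu> \<Otimes>\<^sub>M \<nu>) (case_prod K))"
    unfolding Wpp_def by (rule INF_lower[OF c])
  also have "\<dots> = (\<integral>\<^sup>+ z. case_prod K z * ennreal (dist (fst z) (snd z) powr p) \<partial>(\<mu> \<Otimes>\<^sub>M \<nu>))"
    by (subst nn_integral_density) auto
  also have "\<dots> = (\<integral>\<^sup>+ x. \<integral>\<^sup>+ y. K x y * ennreal (dist x y powr p) \<partial>\<nu> \<partial>\<mu>)"
    by (subst \<nu>.nn_integral_fst[symmetric]) auto
  \<comment> \<open>On the independent part the distance is bounded through the origin. Each of the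
    two resulting terms has a moment in one variable only, so the defect in the other variable
    integrates to \<open>s\<close> and cancels the normalization.\<close>
  also have "\<dots> \<le> (\<integral>\<^sup>+ x. \<integral>\<^sup>+ y. k x y * ennreal (dist x y powr p) +
      ennreal (2 powr p) * ((1 - F x) * ennreal (norm x powr p) * (1 - G y) / s + (1 - G y) * ennreal (norm y powr p) * (1 - F x) / s) \<partial>\<nu> \<partial>\<mu>)"
  proof (intro nn_integral_mono)
    fix x y :: 'a
    have "dist x y powr p \<le> (norm x + norm y) powr p"
      using p by (intro powr_mono2) (auto simp: dist_norm norm_triangle_ineq4)
    also have "\<dots> \<le> 2 powr p * (norm x powr p + norm y powr p)"
      by (rule powr_add_le) (use p in auto)
    finally have "ennreal (dist x y powr p) \<le> ennreal (2 powr p) * (ennreal (norm x powr p) + ennreal (norm y powr p))"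
      by (simp add: ennreal_mult'[symmetric] ennreal_plus[symmetric] del: ennreal_plus)
    then have "(1 - F x) * (1 - G y) / s * ennreal (dist x y powr p)
        \<le> (1 - F x) * (1 - G y) / s * (ennreal (2 powr p) * (ennreal (norm x powr p) + ennreal (norm y powr p)))"
      by (intro mult_left_mono) auto
    also have "\<dots> = ennreal (2 powr p) * ((1 - F x) * ennreal (norm x powr p) * (1 - G y) / s + (1 - G y) * ennreal (norm y powr p) * (1 - F x) / s)"
      by (simp add: divide_ennreal_def algebra_simps)
    finally show "K x y * ennreal (dist x y powr p) \<le> k x y * ennreal (dist x y powr p) +
      ennreal (2 powr p) * ((1 - F x) * ennreal (norm x powr p) * (1 - G y) / s + (1 - G y) * ennreal (norm y powr p) * (1 - F x) / s)"
      by (simp add: K_def distrib_right add_left_mono)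
  qed
  also have "\<dots> = (\<integral>\<^sup>+ x. (\<integral>\<^sup>+ y. k x y * ennreal (dist x y powr p) \<partial>\<nu>) +
      ennreal (2 powr p) * ((1 - F x) * ennreal (norm x powr p) * s / s + (\<integral>\<^sup>+ y. (1 - G y) * ennreal (norm y powr p) \<partial>\<nu>) * (1 - F x) / s) \<partial>\<mu>)"
    by (intro nn_integral_cong)
      (simp add: nn_integral_add nn_integral_cmult nn_integral_multc nn_integral_divide s2)
  also have "\<dots> = (\<integral>\<^sup>+ x. (\<integral>\<^sup>+ y. k x y * ennreal (dist x y powr p) \<partial>\<nu>) \<partial>\<mu>) +
      ennreal (2 powr p) * ((\<integral>\<^sup>+ x. (1 - F x) * ennreal (norm x powr p) \<partial>\<mu>) * s / s + (\<integral>\<^sup>+ y. (1 - G y) * ennreal (norm y powr p) \<partial>\<nu>) * s / s)"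
    by (simp add: nn_integral_add nn_integral_cmult nn_integral_multc nn_integral_divide s_def[symmetric])
  also have "\<dots> \<le> (\<integral>\<^sup>+ x. \<integral>\<^sup>+ y. k x y * ennreal (dist x y powr p) \<partial>\<nu> \<partial>\<mu>)
    + ennreal (2 powr p) * ((\<integral>\<^sup>+ x. (1 - F x) * ennreal (norm x powr p) \<partial>\<mu>)
        + (\<integral>\<^sup>+ y. (1 - G y) * ennreal (norm y powr p) \<partial>\<nu>))"
    by (intro add_left_mono mult_left_mono add_mono ss1) auto
  finally show ?thesis .
qed

lemma nn_integral_smoothing_marginal:
  fixes \<nu> :: "'a::euclidean_space measure" and \<kappa> :: "'a \<Rightarrow> 'a \<Rightarrow> ennreal"
  assumes \<nu>: "prob_space \<nu>" "sets \<nu> = sets borel"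
    and \<kappa>[measurable]: "case_prod \<kappa> \<in> borel_measurable (borel \<Otimes>\<^sub>M borel)"
    and g[measurable]: "g \<in> borel_measurable borel"
  shows "(\<integral>\<^sup>+ x'. \<integral>\<^sup>+ y. g y * \<kappa> y x' \<partial>lborel \<partial>\<nu>) = (\<integral>\<^sup>+ y. g y * (\<integral>\<^sup>+ x'. \<kappa> y x' \<partial>\<nu>) \<partial>lborel)"
proof -
  note [measurable_cong] = \<nu>(2)
  interpret \<nu>: prob_space \<nu> by fact
  interpret pair_sigma_finite lborel \<nu> ..
  have "(\<integral>\<^sup>+ x'. \<integral>\<^sup>+ y. g y * \<kappa> y x' \<partial>lborel \<partial>\<nu>) = (\<integral>\<^sup>+ y. \<integral>\<^sup>+ x'. g y * \<kappa> y x' \<partial>\<nu> \<partial>lborel)"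
    by (rule Fubini') measurable
  also have "\<dots> = (\<integral>\<^sup>+ y. g y * (\<integral>\<^sup>+ x'. \<kappa> y x' \<partial>\<nu>) \<partial>lborel)"
    by (intro nn_integral_cong nn_integral_cmult) simp
  finally show ?thesis .
qed

text \<open>The cost of one leg of the path from \<open>x\<close> through \<open>y\<close> to
  \<open>x'\<close>. Integrating out the far endpoint leaves a retention weight of at most 1, so the
  leg costs no more than the unrestricted move from \<open>x\<close> to \<open>y\<close>. With the
  measures exchanged the same bound serves the other leg.\<close>

lemma nn_integral_smoothing_cost:
  fixes \<mu> \<nu> :: "'a::euclidean_space measure" and \<kappa> :: "'a \<Rightarrow> 'a \<Rightarrow> ennreal"
  assumes \<mu>: "prob_space \<mu>" "sets \<mu> = sets borel" and \<nu>: "prob_space \<nu>" "sets \<nu> = sets borel"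
    and \<kappa>[measurable]: "case_prod \<kappa> \<in> borel_measurable (borel \<Otimes>\<^sub>M borel)"
    and w[measurable]: "w \<in> borel_measurable borel"
    and le: "\<And>y. w y * (\<integral>\<^sup>+ x. \<kappa> y x \<partial>\<nu>) \<le> 1"
    and V: "\<And>x. (\<integral>\<^sup>+ y. \<kappa> y x * ennreal (dist x y powr p) \<partial>lborel) \<le> V"
  shows "(\<integral>\<^sup>+ x. \<integral>\<^sup>+ x'. \<integral>\<^sup>+ y. (w y * \<kappa> y x * ennreal (dist x y powr p)) * \<kappa> y x' \<partial>lborel \<partial>\<nu> \<partial>\<mu>) \<le> V"
proof -
  note [measurable_cong] = \<mu>(2) \<nu>(2)
  interpret \<mu>: prob_space \<mu> by fact
  have "(\<integral>\<^sup>+ x'. \<integral>\<^sup>+ y. (w y * \<kappa> y x * ennreal (dist x y powr p)) * \<kappa> y x' \<partial>lborel \<partial>\<nu>) \<le> V" for x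
  proof -
    have "(\<integral>\<^sup>+ x'. \<integral>\<^sup>+ y. (w y * \<kappa> y x * ennreal (dist x y powr p)) * \<kappa> y x' \<partial>lborel \<partial>\<nu>)
        = (\<integral>\<^sup>+ y. (w y * \<kappa> y x * ennreal (dist x y powr p)) * (\<integral>\<^sup>+ x'. \<kappa> y x' \<partial>\<nu>) \<partial>lborel)"
      by (rule nn_integral_smoothing_marginal[OF \<nu>]) measurable
    also have "\<dots> \<le> (\<integral>\<^sup>+ y. \<kappa> y x * ennreal (dist x y powr p) \<partial>lborel)"
    proof (rule nn_integral_mono)
      fix y
      have "(w y * \<kappa> y x * ennreal (dist x y powr p)) * (\<integral>\<^sup>+ x'. \<kappa> y x' \<partial>\<nu>)
          = (\<kappa> y x * ennreal (dist x y powr p)) * (w y * (\<integral>\<^sup>+ x'. \<kappa> y x' \<partial>\<nu>))" by (simp add: ac_simps)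
      also have "\<dots> \<le> (\<kappa> y x * ennreal (dist x y powr p)) * 1"
        by (intro mult_left_mono le) auto
      finally show "(w y * \<kappa> y x * ennreal (dist x y powr p)) * (\<integral>\<^sup>+ x'. \<kappa> y x' \<partial>\<nu>) \<le> \<kappa> y x * ennreal (dist x y powr p)"
        by simp
    qed
    also have "\<dots> \<le> V" by (rule V)
    finally show ?thesis .
  qed
  then have "(\<integral>\<^sup>+ x. \<integral>\<^sup>+ x'. \<integral>\<^sup>+ y. (w y * \<kappa> y x * ennreal (dist x y powr p)) * \<kappa> y x' \<partial>lborel \<partial>\<nu> \<partial>\<mu>) \<le> (\<integral>\<^sup>+ x. V \<partial>\<mu>)"
    by (intro nn_integral_mono)
  then show ?thesis by (simp add: \<mu>.emeasure_space_1)
qed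

text \<open>Split at radius \<open>R\<close>: inside, the moment is at most \<open>R powr p\<close>
  times the uncovered mass; outside, the defect is at most 1 and the tail moment remains.\<close>

lemma nn_integral_uncovered_moment_le:
  fixes \<mu> :: "'a::euclidean_space measure" and \<kappa> :: "'a \<Rightarrow> 'a \<Rightarrow> ennreal"
  assumes \<mu>: "prob_space \<mu>" "sets \<mu> = sets borel"
    and \<kappa>[measurable]: "case_prod \<kappa> \<in> borel_measurable (borel \<Otimes>\<^sub>M borel)"
    and \<kappa>1: "\<And>x. (\<integral>\<^sup>+ y. \<kappa> y x \<partial>lborel) = 1"
    and \<alpha>[measurable]: "\<alpha> \<in> borel_measurable borel" and \<alpha>1: "\<And>y. \<alpha> y \<le> 1"
    and p: "0 \<le> p" and R: "0 \<le> R"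
  shows "(\<integral>\<^sup>+ x. (1 - (\<integral>\<^sup>+ y. \<alpha> y * \<kappa> y x \<partial>lborel)) * ennreal (norm x powr p) \<partial>\<mu>)
    \<le> ennreal (R powr p) * (1 - (\<integral>\<^sup>+ y. \<alpha> y * (\<integral>\<^sup>+ x. \<kappa> y x \<partial>\<mu>) \<partial>lborel))
      + (\<integral>\<^sup>+ x. ennreal (norm x powr p) * indicator {x. R < norm x} x \<partial>\<mu>)"
proof -
  note [measurable_cong] = \<mu>(2)
  interpret \<mu>: prob_space \<mu> by fact
  let ?F = "\<lambda>x. \<integral>\<^sup>+ y. \<alpha> y * \<kappa> y x \<partial>lborel"
  have F1: "?F x \<le> 1" for x
  proof -
    have "?F x \<le> (\<integral>\<^sup>+ y. 1 * \<kappa> y x \<partial>lborel)"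
      by (intro nn_integral_mono mult_right_mono \<alpha>1) auto
    then show ?thesis by (simp add: \<kappa>1)
  qed
  have Fint: "(\<integral>\<^sup>+ x. ?F x \<partial>\<mu>) = (\<integral>\<^sup>+ y. \<alpha> y * (\<integral>\<^sup>+ x. \<kappa> y x \<partial>\<mu>) \<partial>lborel)"
    by (rule nn_integral_smoothing_marginal[OF \<mu>]) measurable
  have fin: "(\<integral>\<^sup>+ x. ?F x \<partial>\<mu>) \<noteq> \<infinity>"
    using nn_integral_mono[of \<mu> ?F "\<lambda>_. 1"] F1 by (auto simp: \<mu>.emeasure_space_1 top_unique)
  have "(\<integral>\<^sup>+ x. (1 - ?F x) * ennreal (norm x powr p) \<partial>\<mu>)
      \<le> (\<integral>\<^sup>+ x. ennreal (R powr p) * (1 - ?F x) + ennreal (norm x powr p) * indicator {x. R < norm x} x \<partial>\<mu>)"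
  proof (rule nn_integral_mono)
    fix x
    show "(1 - ?F x) * ennreal (norm x powr p)
        \<le> ennreal (R powr p) * (1 - ?F x) + ennreal (norm x powr p) * indicator {x. R < norm x} x"
    proof (cases "R < norm x")
      case True
      have "(1 - ?F x) * ennreal (norm x powr p) \<le> 1 * ennreal (norm x powr p)"
        by (intro mult_right_mono) auto
      also have "\<dots> \<le> ennreal (R powr p) * (1 - ?F x) + ennreal (norm x powr p)"
        by simp
      finally show ?thesis using True by simp
    next
      case False
      then have "(1 - ?F x) * ennreal (norm x powr p) \<le> (1 - ?F x) * ennreal (R powr p)"
        using p by (intro mult_left_mono ennreal_leI powr_mono2) auto
      with False show ?thesis by (simp add: mult.commute)
    qed
  qed
  also have "\<dots> = ennreal (R powr p) * (\<integral>\<^sup>+ x. (1 - ?F x) \<partial>\<mu>) + (\<integral>\<^sup>+ x. ennreal (norm x powr p) * indicator {x. R < norm x} x \<partial>\<mu>)"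
    by (simp add: nn_integral_add nn_integral_cmult)
  also have "(\<integral>\<^sup>+ x. (1 - ?F x) \<partial>\<mu>) = 1 - (\<integral>\<^sup>+ x. ?F x \<partial>\<mu>)"
    using fin F1 by (subst nn_integral_diff) (auto simp: \<mu>.emeasure_space_1)
  finally show ?thesis unfolding Fint .
qed

text \<open>The coupling moves \<open>x\<close> to \<open>y\<close> with law \<open>\<kappa> y x dy\<close>, keeps the common part of the two
  smoothed densities, and moves back from \<open>y\<close> to \<open>x'\<close>.\<close>

lemma Wpp_le_smoothing:
  fixes \<mu> \<nu> :: "'a::euclidean_space measure" and \<kappa> :: "'a \<Rightarrow> 'a \<Rightarrow> ennreal"
  assumes \<mu>: "prob_space \<mu>" "sets \<mu> = sets borel" and \<nu>: "prob_space \<nu>" "sets \<nu> = sets borel"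
    and \<kappa>[measurable]: "case_prod \<kappa> \<in> borel_measurable (borel \<Otimes>\<^sub>M borel)"
    and \<kappa>1: "\<And>x. (\<integral>\<^sup>+ y. \<kappa> y x \<partial>lborel) = 1"
    and a: "\<And>y. (\<integral>\<^sup>+ x. \<kappa> y x \<partial>\<mu>) = a y" "\<And>y. 0 < a y" "\<And>y. a y < \<infinity>"
    and b: "\<And>y. (\<integral>\<^sup>+ x. \<kappa> y x \<partial>\<nu>) = b y" "\<And>y. 0 < b y" "\<And>y. b y < \<infinity>"
    and V: "\<And>x. (\<integral>\<^sup>+ y. \<kappa> y x * ennreal (dist x y powr p) \<partial>lborel) \<le> V"
    and p: "0 \<le> p" and R: "0 \<le> R"
  shows "Wpp p \<mu> \<nu> \<le> ennreal (2 powr p) * (2 * V + 2 * ennreal (R powr p) * (1 - (\<integral>\<^sup>+ y. min (a y) (b y) \<partial>lborel))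
      + (\<integral>\<^sup>+ x. ennreal (norm x powr p) * indicator {x. R < norm x} x \<partial>\<mu>)
      + (\<integral>\<^sup>+ x. ennreal (norm x powr p) * indicator {x. R < norm x} x \<partial>\<nu>))"
proof -
  note [measurable_cong] = \<mu>(2) \<nu>(2)
  interpret \<mu>: prob_space \<mu> by fact
  interpret \<nu>: prob_space \<nu> by fact
  interpret pair_prob_space \<mu> \<nu> ..
  have a': "a = (\<lambda>y. \<integral>\<^sup>+ x. \<kappa> y x \<partial>\<mu>)" and b': "b = (\<lambda>y. \<integral>\<^sup>+ x. \<kappa> y x \<partial>\<nu>)"
    using a b by auto
  have ma[measurable]: "a \<in> borel_measurable borel" unfolding a' by measurable
  have mb[measurable]: "b \<in> borel_measurable borel" unfolding b' by measurable
  \<comment> \<open>Weighting a path through \<open>y\<close> by \<open>1 / max (a y) (b y)\<close>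
    gives the midpoint the density \<open>a * b / max a b\<close>, which is \<open>min a b\<close>,
    the common part. Strict positivity and finiteness of the densities make the inverse
    genuine.\<close>
  define w where "w y = inverse (max (a y) (b y))" for y
  have mw[measurable]: "w \<in> borel_measurable borel" unfolding w_def by measurable
  have pos: "max (a y) (b y) \<noteq> 0" "max (a y) (b y) \<noteq> top" for y
    using a(2,3)[of y] b(2,3)[of y] by (auto simp: max_def)
  have w1: "w y * max (a y) (b y) = 1" for y
    unfolding w_def using pos[of y]
    by (simp add: mult.commute less_top flip: divide_ennreal_def)
  have wa: "w y * a y \<le> 1" and wb: "w y * b y \<le> 1" for y
    using w1[of y] mult_left_mono[of "a y" "max (a y) (b y)" "w y"] mult_left_mono[of "b y" "max (a y) (b y)" "w y"] by auto
  have wab: "w y * b y * a y = min (a y) (b y)" for y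
  proof -
    have "w y * b y * a y = w y * max (a y) (b y) * min (a y) (b y)"
      by (auto simp: max_def min_def ac_simps)
    then show ?thesis by (simp add: w1)
  qed
  have wba: "w y * a y * b y = min (a y) (b y)" for y
    using wab[of y] by (simp add: ac_simps)
  define k where "k x x' = (\<integral>\<^sup>+ y. w y * \<kappa> y x * \<kappa> y x' \<partial>lborel)" for x x'
  have mk[measurable]: "case_prod k \<in> borel_measurable (borel \<Otimes>\<^sub>M borel)" unfolding k_def by measurable
  \<comment> \<open>The factor \<open>w y * b y\<close> equals \<open>min (a y) (b y) / a y\<close>,
    the fraction of the mass arriving at \<open>y\<close> from \<open>\<mu>\<close> that is kept; in
    \<open>G\<close> it is the corresponding fraction for \<open>\<nu>\<close>.\<close>
  define F where "F x = (\<integral>\<^sup>+ y. w y * b y * \<kappa> y x \<partial>lborel)" for x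
  define G where "G x = (\<integral>\<^sup>+ y. w y * a y * \<kappa> y x \<partial>lborel)" for x
  have kF: "(\<integral>\<^sup>+ x'. k x x' \<partial>\<nu>) = F x" for x
    unfolding k_def F_def
    by (subst nn_integral_smoothing_marginal[OF \<nu>]) (auto simp: b(1) ac_simps)
  have kG: "(\<integral>\<^sup>+ x. k x x' \<partial>\<mu>) = G x'" for x'
  proof -
    have "(\<integral>\<^sup>+ x. k x x' \<partial>\<mu>) = (\<integral>\<^sup>+ x. \<integral>\<^sup>+ y. (w y * \<kappa> y x') * \<kappa> y x \<partial>lborel \<partial>\<mu>)"
      unfolding k_def by (simp add: ac_simps)
    also have "\<dots> = G x'"
      unfolding G_def by (subst nn_integral_smoothing_marginal[OF \<mu>]) (auto simp: a(1) ac_simps)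
    finally show ?thesis .
  qed
  have le1: "(\<integral>\<^sup>+ y. \<alpha> y * \<kappa> y x \<partial>lborel) \<le> 1" if "\<And>y. \<alpha> y \<le> 1" for \<alpha> x
  proof -
    have "(\<integral>\<^sup>+ y. \<alpha> y * \<kappa> y x \<partial>lborel) \<le> (\<integral>\<^sup>+ y. 1 * \<kappa> y x \<partial>lborel)"
      by (intro nn_integral_mono mult_right_mono that) auto
    then show ?thesis by (simp add: \<kappa>1)
  qed
  have F1: "F x \<le> 1" for x unfolding F_def by (rule le1) (rule wb)
  have G1: "G x \<le> 1" for x unfolding G_def by (rule le1) (rule wa)
  let ?T = "\<lambda>\<mu>::'a measure. \<integral>\<^sup>+ x. ennreal (norm x powr p) * indicator {x. R < norm x} x \<partial>\<mu>"
  let ?m = "\<integral>\<^sup>+ y. min (a y) (b y) \<partial>lborel"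
  have cost: "(\<integral>\<^sup>+ x. \<integral>\<^sup>+ x'. k x x' * ennreal (dist x x' powr p) \<partial>\<nu> \<partial>\<mu>) \<le> ennreal (2 powr p) * (2 * V)"
  proof -
    have "(\<integral>\<^sup>+ x. \<integral>\<^sup>+ x'. k x x' * ennreal (dist x x' powr p) \<partial>\<nu> \<partial>\<mu>)
      \<le> (\<integral>\<^sup>+ x. \<integral>\<^sup>+ x'. ennreal (2 powr p) * ((\<integral>\<^sup>+ y. (w y * \<kappa> y x * ennreal (dist x y powr p)) * \<kappa> y x' \<partial>lborel)
          + (\<integral>\<^sup>+ y. (w y * \<kappa> y x' * ennreal (dist x' y powr p)) * \<kappa> y x \<partial>lborel)) \<partial>\<nu> \<partial>\<mu>)"
    proof (intro nn_integral_mono)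
      fix x x' :: 'a
      \<comment> \<open>The triangle inequality through an arbitrary midpoint. Inserted under the
        integral that defines \<open>k\<close>, it separates the two legs.\<close>
      have *: "ennreal (dist x x' powr p) \<le> ennreal (2 powr p) * (ennreal (dist x y powr p) + ennreal (dist x' y powr p))" for y
      proof -
        have "dist x x' powr p \<le> (dist x y + dist x' y) powr p"
          using p by (intro powr_mono2) (auto simp: dist_triangle2)
        also have "\<dots> \<le> 2 powr p * (dist x y powr p + dist x' y powr p)"
          by (rule powr_add_le) (use p in auto)
        finally show ?thesis
          by (simp add: ennreal_mult'[symmetric] ennreal_plus[symmetric] del: ennreal_plus)
      qed
      have "k x x' * ennreal (dist x x' powr p) = (\<integral>\<^sup>+ y. w y * \<kappa> y x * \<kappa> y x' * ennreal (dist x x' powr p) \<partial>lborel)"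
        unfolding k_def by (simp add: nn_integral_multc)
      also have "\<dots> \<le> (\<integral>\<^sup>+ y. w y * \<kappa> y x * \<kappa> y x' * (ennreal (2 powr p) * (ennreal (dist x y powr p) + ennreal (dist x' y powr p))) \<partial>lborel)"
        by (intro nn_integral_mono mult_left_mono *) auto
      also have "\<dots> = (\<integral>\<^sup>+ y. ennreal (2 powr p) * ((w y * \<kappa> y x * ennreal (dist x y powr p)) * \<kappa> y x' + (w y * \<kappa> y x' * ennreal (dist x' y powr p)) * \<kappa> y x) \<partial>lborel)"
        by (simp add: algebra_simps)
      also have "\<dots> = ennreal (2 powr p) * ((\<integral>\<^sup>+ y. (w y * \<kappa> y x * ennreal (dist x y powr p)) * \<kappa> y x' \<partial>lborel)
          + (\<integral>\<^sup>+ y. (w y * \<kappa> y x' * ennreal (dist x' y powr p)) * \<kappa> y x \<partial>lborel))"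
        by (subst nn_integral_cmult) (auto intro!: arg_cong2[where f="(*)"] nn_integral_add)
      finally show "k x x' * ennreal (dist x x' powr p) \<le> ennreal (2 powr p) * ((\<integral>\<^sup>+ y. (w y * \<kappa> y x * ennreal (dist x y powr p)) * \<kappa> y x' \<partial>lborel)
          + (\<integral>\<^sup>+ y. (w y * \<kappa> y x' * ennreal (dist x' y powr p)) * \<kappa> y x \<partial>lborel))" .
    qed
    also have "\<dots> = ennreal (2 powr p) * ((\<integral>\<^sup>+ x. \<integral>\<^sup>+ x'. \<integral>\<^sup>+ y. (w y * \<kappa> y x * ennreal (dist x y powr p)) * \<kappa> y x' \<partial>lborel \<partial>\<nu> \<partial>\<mu>)
          + (\<integral>\<^sup>+ x. \<integral>\<^sup>+ x'. \<integral>\<^sup>+ y. (w y * \<kappa> y x' * ennreal (dist x' y powr p)) * \<kappa> y x \<partial>lborel \<partial>\<nu> \<partial>\<mu>))"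
      by (simp add: nn_integral_cmult nn_integral_add)
    \<comment> \<open>Exchanging the order makes \<open>x'\<close> the outer variable, so the return
      leg takes the shape of \<open>nn_integral_smoothing_cost\<close> with the measures
      swapped.\<close>
    also have "(\<integral>\<^sup>+ x. \<integral>\<^sup>+ x'. \<integral>\<^sup>+ y. (w y * \<kappa> y x' * ennreal (dist x' y powr p)) * \<kappa> y x \<partial>lborel \<partial>\<nu> \<partial>\<mu>)
        = (\<integral>\<^sup>+ x'. \<integral>\<^sup>+ x. \<integral>\<^sup>+ y. (w y * \<kappa> y x' * ennreal (dist x' y powr p)) * \<kappa> y x \<partial>lborel \<partial>\<mu> \<partial>\<nu>)"
      by (rule Fubini'[symmetric]) measurable
    also have "ennreal (2 powr p) * ((\<integral>\<^sup>+ x. \<integral>\<^sup>+ x'. \<integral>\<^sup>+ y. (w y * \<kappa> y x * ennreal (dist x y powr p)) * \<kappa> y x' \<partial>lborel \<partial>\<nu> \<partial>\<mu>)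
          + (\<integral>\<^sup>+ x'. \<integral>\<^sup>+ x. \<integral>\<^sup>+ y. (w y * \<kappa> y x' * ennreal (dist x' y powr p)) * \<kappa> y x \<partial>lborel \<partial>\<mu> \<partial>\<nu>))
        \<le> ennreal (2 powr p) * (V + V)"
      by (intro mult_left_mono add_mono nn_integral_smoothing_cost[OF \<mu> \<nu> \<kappa> mw _ V] nn_integral_smoothing_cost[OF \<nu> \<mu> \<kappa> mw _ V])
        (auto simp: a(1) b(1) wa wb)
    finally show ?thesis by (simp add: mult_2)
  qed
  have uF: "(\<integral>\<^sup>+ x. (1 - F x) * ennreal (norm x powr p) \<partial>\<mu>) \<le> ennreal (R powr p) * (1 - ?m) + ?T \<mu>"
    using nn_integral_uncovered_moment_le[OF \<mu> \<kappa> \<kappa>1, of "\<lambda>y. w y * b y", OF _ wb p R] by (simp add: F_def a(1) wab)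
  have uG: "(\<integral>\<^sup>+ x. (1 - G x) * ennreal (norm x powr p) \<partial>\<nu>) \<le> ennreal (R powr p) * (1 - ?m) + ?T \<nu>"
    using nn_integral_uncovered_moment_le[OF \<nu> \<kappa> \<kappa>1, of "\<lambda>y. w y * a y", OF _ wa p R] by (simp add: G_def b(1) wba)
  have "Wpp p \<mu> \<nu> \<le> (\<integral>\<^sup>+ x. \<integral>\<^sup>+ y. k x y * ennreal (dist x y powr p) \<partial>\<nu> \<partial>\<mu>)
    + ennreal (2 powr p) * ((\<integral>\<^sup>+ x. (1 - F x) * ennreal (norm x powr p) \<partial>\<mu>)
        + (\<integral>\<^sup>+ y. (1 - G y) * ennreal (norm y powr p) \<partial>\<nu>))"
    by (rule Wpp_le_partial_coupling[OF \<mu> \<nu> p mk kF F1 kG G1])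
  also have "\<dots> \<le> ennreal (2 powr p) * (2 * V)
    + ennreal (2 powr p) * ((ennreal (R powr p) * (1 - ?m) + ?T \<mu>) + (ennreal (R powr p) * (1 - ?m) + ?T \<nu>))"
    by (intro add_mono mult_left_mono cost uF uG) auto
  also have "\<dots> = ennreal (2 powr p) * (2 * V + 2 * ennreal (R powr p) * (1 - ?m) + ?T \<mu> + ?T \<nu>)"
    by (simp add: distrib_left mult_2 distrib_right ac_simps)
  finally show ?thesis .
qed

section \<open>The Gaussian kernel\<close>

text \<open>The density in \<open>y\<close> of the normal law with mean \<open>x\<close> and
  standard deviation \<open>e\<close> in each coordinate. The argument order matches the kernel
  \<open>\<kappa> y x\<close> of the smoothing.\<close>

definition gauss :: "real \<Rightarrow> 'a::euclidean_space \<Rightarrow> 'a \<Rightarrow> real" where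
  "gauss e y x = (1 / sqrt (2 * pi * e\<^sup>2)) ^ DIM('a) * exp (- (dist x y)\<^sup>2 / (2 * e\<^sup>2))"

lemma measurable_gauss[measurable (raw)]:
  fixes f g :: "'b \<Rightarrow> 'a::euclidean_space"
  assumes [measurable]: "f \<in> borel_measurable M" "g \<in> borel_measurable M"
  shows "(\<lambda>x. gauss e (f x) (g x)) \<in> borel_measurable M"
  unfolding gauss_def by measurable

lemma gauss_pos: "0 < e \<Longrightarrow> 0 < gauss e y x"
  by (simp add: gauss_def)

lemma gauss_nonneg [simp]: "0 \<le> gauss e y x"
  by (simp add: gauss_def)

lemma gauss_le: "gauss e y (x::'a::euclidean_space) \<le> (1 / sqrt (2 * pi * e\<^sup>2)) ^ DIM('a)"
  unfolding gauss_def by (intro mult_left_le) auto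

text \<open>Normalization, moments and Fourier transform all reduce to one dimension through this
  factorization.\<close>

lemma gauss_eq_prod: "gauss e y x = (\<Prod>b\<in>Basis. normal_density (x \<bullet> b) e (y \<bullet> b))"
proof -
  have "(dist x y)\<^sup>2 = (\<Sum>b\<in>Basis. (y \<bullet> b - x \<bullet> b)\<^sup>2)"
    by (subst euclidean_dist_l2) (simp add: L2_set_def sum_nonneg dist_real_def power2_commute)
  then have "exp (- (dist x y)\<^sup>2 / (2 * e\<^sup>2)) = (\<Prod>b\<in>Basis. exp (- (y \<bullet> b - x \<bullet> b)\<^sup>2 / (2 * e\<^sup>2)))"
    by (simp add: exp_sum[symmetric] sum_negf sum_divide_distrib)
  then show ?thesis
    unfolding gauss_def normal_density_def prod.distrib prod_constant by simp
qed

lemma nn_integral_normal_density: "0 < e \<Longrightarrow> (\<integral>\<^sup>+ t. ennreal (normal_density m e t) \<partial>lborel) = 1"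
  by (subst nn_integral_eq_integral) auto

lemma nn_integral_gauss: "0 < e \<Longrightarrow> (\<integral>\<^sup>+ y. ennreal (gauss e y x) \<partial>lborel) = 1"
  by (simp add: gauss_eq_prod prod_ennreal[symmetric] normal_density_nonneg nn_integral_normal_density
      nn_integral_lborel_prod[of "\<lambda>b t. ennreal (normal_density (x \<bullet> b) e t)"])

text \<open>A real exponent is dominated by an even integer one: with
  \<open>s = \<bar>t - m\<bar> / e\<close>, \<open>s powr p\<close> is at most
  \<open>1 + s ^ (2 * k)\<close>. The quotient of factorials is the moment of order
  \<open>2 * k\<close> of the standard normal law, and rescaling by \<open>e\<close> produces
  \<open>e powr p\<close>.\<close>

lemma nn_integral_normal_density_powr_le:
  assumes e: "0 < e" and p: "p \<le> 2 * real k" "0 \<le> p"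
  shows "(\<integral>\<^sup>+ t. ennreal (normal_density m e t * \<bar>t - m\<bar> powr p) \<partial>lborel)
    \<le> ennreal (e powr p * (1 + fact (2 * k) / (2 ^ k * fact k)))"
proof -
  have "(\<integral>\<^sup>+ t. ennreal (normal_density m e t * \<bar>t - m\<bar> powr p) \<partial>lborel)
      \<le> (\<integral>\<^sup>+ t. ennreal (e powr p * normal_density m e t + e powr p / e ^ (2 * k) * (normal_density m e t * (t - m) ^ (2 * k))) \<partial>lborel)"
  proof (intro nn_integral_mono ennreal_leI)
    fix t
    let ?s = "\<bar>t - m\<bar> / e"
    have "?s powr p \<le> 1 + ?s ^ (2 * k)"
    proof (cases "?s \<le> 1")
      case True
      then have "?s powr p \<le> 1 powr p" using e p by (intro powr_mono2) auto
      moreover have "0 \<le> ?s ^ (2 * k)" using e by auto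
      ultimately show ?thesis unfolding powr_one_eq_one by linarith
    next
      case False
      then have "?s powr p \<le> ?s powr real (2 * k)" using p by (intro powr_mono) auto
      also have "\<dots> = ?s ^ (2 * k)" using False by (subst powr_realpow) auto
      finally show ?thesis by simp
    qed
    then have "e powr p * ?s powr p \<le> e powr p * (1 + ?s ^ (2 * k))"
      by (rule mult_left_mono) auto
    moreover have "e powr p * ?s powr p = \<bar>t - m\<bar> powr p"
      using e by (simp add: powr_divide)
    moreover have "?s ^ (2 * k) = (t - m) ^ (2 * k) / e ^ (2 * k)"
      by (simp add: power_divide power_even_abs)
    ultimately have "\<bar>t - m\<bar> powr p \<le> e powr p * (1 + (t - m) ^ (2 * k) / e ^ (2 * k))" by simp
    then have "normal_density m e t * \<bar>t - m\<bar> powr p \<le> normal_density m e t * (e powr p * (1 + (t - m) ^ (2 * k) / e ^ (2 * k)))"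
      by (rule mult_left_mono) (auto simp: normal_density_nonneg)
    then show "normal_density m e t * \<bar>t - m\<bar> powr p
        \<le> e powr p * normal_density m e t + e powr p / e ^ (2 * k) * (normal_density m e t * (t - m) ^ (2 * k))"
      by (simp add: algebra_simps)
  qed
  also have "\<dots> = ennreal (\<integral>t. e powr p * normal_density m e t + e powr p / e ^ (2 * k) * (normal_density m e t * (t - m) ^ (2 * k)) \<partial>lborel)"
    using e by (intro nn_integral_eq_integral Bochner_Integration.integrable_add integrable_mult_right integrable.intros[OF normal_moment_even])
      (auto intro!: AE_I2 add_nonneg_nonneg mult_nonneg_nonneg simp: normal_density_nonneg)
  also have "(\<integral>t. e powr p * normal_density m e t + e powr p / e ^ (2 * k) * (normal_density m e t * (t - m) ^ (2 * k)) \<partial>lborel)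
      = e powr p * 1 + e powr p / e ^ (2 * k) * (fact (2 * k) / ((2 / e\<^sup>2) ^ k * fact k))"
    using e by (subst Bochner_Integration.integral_add)
      (auto simp: integral_normal_moment_even[OF e] intro!: integrable_mult_right integrable.intros[OF normal_moment_even])
  also have "\<dots> = e powr p * (1 + fact (2 * k) / (2 ^ k * fact k))"
    using e by (simp add: power_divide power_mult[symmetric] algebra_simps)
  finally show ?thesis .
qed

text \<open>The norm is at most the dimension times the largest coordinate, whose power is one of
  the summands.\<close>

lemma norm_powr_le_sum_Basis:
  fixes x :: "'a::euclidean_space"
  assumes "0 \<le> p"
  shows "norm x powr p \<le> real DIM('a) powr p * (\<Sum>b\<in>Basis. \<bar>x \<bullet> b\<bar> powr p)"
proof -
  let ?M = "Max ((\<lambda>b. \<bar>x \<bullet> b\<bar>) ` Basis)"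
  have "?M \<in> (\<lambda>b. \<bar>x \<bullet> b\<bar>) ` Basis" by (rule Max_in) auto
  then obtain b0 where b0: "b0 \<in> Basis" "?M = \<bar>x \<bullet> b0\<bar>" by blast
  have "norm x \<le> (\<Sum>b\<in>Basis. \<bar>x \<bullet> b\<bar>)" by (rule norm_le_l1)
  also have "\<dots> \<le> (\<Sum>b\<in>(Basis::'a set). ?M)" by (rule sum_mono) auto
  also have "\<dots> = real DIM('a) * \<bar>x \<bullet> b0\<bar>" by (simp only: b0 sum_constant)
  finally have "norm x powr p \<le> (real DIM('a) * \<bar>x \<bullet> b0\<bar>) powr p"
    using assms by (intro powr_mono2) auto
  also have "\<dots> = real DIM('a) powr p * \<bar>x \<bullet> b0\<bar> powr p" by (simp add: powr_mult)
  also have "\<bar>x \<bullet> b0\<bar> powr p \<le> (\<Sum>b\<in>Basis. \<bar>x \<bullet> b\<bar> powr p)"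
    using b0(1) by (intro member_le_sum) auto
  finally show ?thesis by (simp add: mult_left_mono)
qed

text \<open>The constant depends on neither \<open>e\<close> nor \<open>x\<close>, so the smoothing
  cost vanishes with \<open>e\<close>, uniformly over all measures.\<close>

lemma gauss_moment:
  assumes p: "0 \<le> p"
  obtains c where "0 \<le> c"
    and "\<And>e x. 0 < e \<Longrightarrow> (\<integral>\<^sup>+ y. ennreal (gauss e y x) * ennreal (dist x (y::'a::euclidean_space) powr p) \<partial>lborel) \<le> ennreal (c * e powr p)"
proof -
  obtain k :: nat where k: "p \<le> 2 * real k" using real_arch_simple[of "p / 2"] by (auto simp: field_simps)
  define m :: real where "m = 1 + fact (2 * k) / (2 ^ k * fact k)"
  have m: "0 \<le> m" by (simp add: m_def)
  let ?d = "real DIM('a)"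
  have "(\<integral>\<^sup>+ y. ennreal (gauss e y x) * ennreal (dist x y powr p) \<partial>lborel) \<le> ennreal (?d powr p * ?d * m * e powr p)"
    if e: "0 < e" for e and x :: 'a
  proof -
    have coord: "(\<integral>\<^sup>+ y. ennreal (gauss e y x) * ennreal (\<bar>(x - y) \<bullet> i\<bar> powr p) \<partial>lborel) \<le> ennreal (e powr p * m)"
      if i: "i \<in> Basis" for i :: 'a
    proof -
      \<comment> \<open>The weight is attached to the single factor \<open>i\<close>; every other
        factor integrates to 1.\<close>
      let ?f = "\<lambda>b t. ennreal (normal_density (x \<bullet> b) e t * (if b = i then \<bar>t - x \<bullet> b\<bar> powr p else 1))"
      have "ennreal (gauss e y x) * ennreal (\<bar>(x - y) \<bullet> i\<bar> powr p) = (\<Prod>b\<in>Basis. ?f b (y \<bullet> b))" for y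
      proof -
        have "(\<Prod>b\<in>Basis. if b = i then \<bar>y \<bullet> b - x \<bullet> b\<bar> powr p else 1) = \<bar>(x - y) \<bullet> i\<bar> powr p"
          using i by (simp add: inner_diff_left abs_minus_commute)
        then show ?thesis
          by (subst prod_ennreal) (auto simp: gauss_eq_prod prod.distrib ennreal_mult[symmetric] prod_nonneg normal_density_nonneg)
      qed
      then have "(\<integral>\<^sup>+ y. ennreal (gauss e y x) * ennreal (\<bar>(x - y) \<bullet> i\<bar> powr p) \<partial>lborel) = (\<integral>\<^sup>+ y. (\<Prod>b\<in>Basis. ?f b (y \<bullet> b)) \<partial>lborel)"
        by simp
      also have "\<dots> = (\<Prod>b\<in>Basis. \<integral>\<^sup>+ t. ?f b t \<partial>lborel)"
        by (rule nn_integral_lborel_prod) auto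
      also have "\<dots> = (\<Prod>b\<in>Basis. if b = i then \<integral>\<^sup>+ t. ennreal (normal_density (x \<bullet> i) e t * \<bar>t - x \<bullet> i\<bar> powr p) \<partial>lborel else 1)"
        using e by (intro prod.cong) (auto simp: nn_integral_normal_density)
      also have "\<dots> = (\<integral>\<^sup>+ t. ennreal (normal_density (x \<bullet> i) e t * \<bar>t - x \<bullet> i\<bar> powr p) \<partial>lborel)"
        using i by simp
      also have "\<dots> \<le> ennreal (e powr p * m)"
        unfolding m_def by (rule nn_integral_normal_density_powr_le) fact+
      finally show ?thesis .
    qed
    have "(\<integral>\<^sup>+ y. ennreal (gauss e y x) * ennreal (dist x y powr p) \<partial>lborel)
        \<le> (\<integral>\<^sup>+ y. ennreal (?d powr p) * (\<Sum>b\<in>Basis. ennreal (gauss e y x) * ennreal (\<bar>(x - y) \<bullet> b\<bar> powr p)) \<partial>lborel)"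
    proof (rule nn_integral_mono)
      fix y
      have "gauss e y x * dist x y powr p \<le> gauss e y x * (?d powr p * (\<Sum>b\<in>Basis. \<bar>(x - y) \<bullet> b\<bar> powr p))"
        unfolding dist_norm by (intro mult_left_mono norm_powr_le_sum_Basis p) auto
      also have "\<dots> = ?d powr p * (\<Sum>b\<in>Basis. gauss e y x * \<bar>(x - y) \<bullet> b\<bar> powr p)"
        by (simp add: sum_distrib_left mult.left_commute)
      finally show "ennreal (gauss e y x) * ennreal (dist x y powr p)
          \<le> ennreal (?d powr p) * (\<Sum>b\<in>Basis. ennreal (gauss e y x) * ennreal (\<bar>(x - y) \<bullet> b\<bar> powr p))"
        by (simp add: ennreal_mult[symmetric] sum_nonneg)
    qed
    also have "\<dots> = ennreal (?d powr p) * (\<Sum>b\<in>Basis. \<integral>\<^sup>+ y. ennreal (gauss e y x) * ennreal (\<bar>(x - y) \<bullet> b\<bar> powr p) \<partial>lborel)"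
      by (subst nn_integral_cmult, simp, subst nn_integral_sum) auto
    also have "\<dots> \<le> ennreal (?d powr p) * (\<Sum>b\<in>(Basis::'a set). ennreal (e powr p * m))"
      by (intro mult_left_mono sum_mono coord) auto
    also have "\<dots> = ennreal (?d powr p * ?d * m * e powr p)"
      using m by (simp add: ennreal_of_nat_eq_real_of_nat ennreal_mult[symmetric] ac_simps)
    finally show ?thesis .
  qed
  with m show ?thesis by (intro that[of "?d powr p * ?d * m"]) auto
qed

section \<open>Fourier representation of the Gaussian\<close>

lemma integrable_gauss: "0 < e \<Longrightarrow> integrable lborel (\<lambda>y. gauss e y x)"
  by (rule integrableI_bounded) (auto simp: nn_integral_gauss)

text \<open>The complex exponential factorizes over coordinates where the cosine does not. The
  product of one-dimensional characteristic functions is computed first, and the real part is taken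
  at the end.\<close>

lemma integral_gauss_cos:
  fixes u :: "'a::euclidean_space"
  shows "(\<integral>z. gauss 1 z 0 * cos (z \<bullet> u) \<partial>lborel) = exp (- (norm u)\<^sup>2 / 2)"
proof -
  interpret P: finite_product_sigma_finite "\<lambda>_. lborel :: real measure" "Basis :: 'a set"
    by standard auto
  let ?f = "\<lambda>b t. complex_of_real (std_normal_density t) * iexp ((u \<bullet> b) * t)"
  have f_int: "integrable lborel (?f b)" for b :: 'a
  proof -
    have "integrable lborel (\<lambda>t. complex_of_real (std_normal_density t))"
      by (intro integrable_of_real) simp
    then show ?thesis
      by (rule Bochner_Integration.integrable_bound) (auto simp: norm_mult)
  qed
  have f_val: "(\<integral>t. ?f b t \<partial>lborel) = complex_of_real (exp (- (u \<bullet> b)\<^sup>2 / 2))" for b :: 'a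
  proof -
    have "(\<integral>t. ?f b t \<partial>lborel) = char std_normal_distribution (u \<bullet> b)"
      unfolding char_def
      by (subst integral_density) (auto simp: normal_density_nonneg scaleR_conv_of_real)
    then show ?thesis by (simp add: char_std_normal_distribution)
  qed
  have prod_eq: "(\<Prod>b\<in>Basis. ?f b (z \<bullet> b)) = complex_of_real (gauss 1 z 0) * iexp (z \<bullet> u)" for z :: 'a
  proof -
    have "(\<Prod>b\<in>Basis. iexp ((u \<bullet> b) * (z \<bullet> b))) = exp (\<Sum>b\<in>Basis. \<i> * complex_of_real ((u \<bullet> b) * (z \<bullet> b)))"
      by (rule exp_sum[symmetric]) simp
    also have "(\<Sum>b\<in>Basis. \<i> * complex_of_real ((u \<bullet> b) * (z \<bullet> b))) = \<i> * complex_of_real (z \<bullet> u)"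
      by (subst euclidean_inner[of z u]) (simp add: sum_distrib_left mult.commute)
    finally show ?thesis
      by (simp add: prod.distrib gauss_eq_prod)
  qed
  have "(\<integral>z. complex_of_real (gauss 1 z 0) * iexp (z \<bullet> u) \<partial>(lborel :: 'a measure)) = (\<integral>z. (\<Prod>b\<in>Basis. ?f b (z \<bullet> b)) \<partial>(lborel :: 'a measure))"
    by (simp only: prod_eq)
  \<comment> \<open>Lebesgue measure is the image of a product of one-dimensional ones under
    assembling coordinates, which gives access to the product rule for integrals.\<close>
  also have "\<dots> = (\<integral>g. (\<Prod>b\<in>Basis. ?f b ((\<Sum>i\<in>Basis. g i *\<^sub>R i) \<bullet> b)) \<partial>(\<Pi>\<^sub>M b\<in>(Basis::'a set). lborel))"
    by (subst lborel_eq, subst integral_distr) auto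
  also have "\<dots> = (\<integral>g. (\<Prod>b\<in>Basis. ?f b (g b)) \<partial>(\<Pi>\<^sub>M b\<in>(Basis::'a set). lborel))"
    by (intro Bochner_Integration.integral_cong refl prod.cong) simp
  also have "\<dots> = (\<Prod>b\<in>Basis. \<integral>t. ?f b t \<partial>lborel)"
    by (rule P.product_integral_prod[OF finite_Basis f_int])
  also have "\<dots> = complex_of_real (\<Prod>b\<in>Basis. exp (- (u \<bullet> b)\<^sup>2 / 2))"
    by (simp only: f_val of_real_prod)
  also have "(\<Prod>b\<in>Basis. exp (- (u \<bullet> b)\<^sup>2 / 2)) = exp (- (norm u)\<^sup>2 / 2)"
    by (subst norm_eq_sqrt_inner) (simp add: euclidean_inner[of u u] sum_nonneg exp_sum[symmetric] sum_negf sum_divide_distrib power2_eq_square)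
  finally have eq: "(\<integral>z. complex_of_real (gauss 1 z 0) * iexp (z \<bullet> u) \<partial>lborel) = complex_of_real (exp (- (norm u)\<^sup>2 / 2))" .
  have int: "integrable lborel (\<lambda>z. complex_of_real (gauss 1 z 0) * iexp (z \<bullet> u))"
  proof -
    have "integrable lborel (\<lambda>z::'a. complex_of_real (gauss 1 z 0))"
      by (intro integrable_of_real integrable_gauss) simp
    then show ?thesis
      by (rule Bochner_Integration.integrable_bound) (auto simp: norm_mult)
  qed
  have "(\<integral>z. gauss 1 z 0 * cos (z \<bullet> u) \<partial>lborel) = (\<integral>z. Re (complex_of_real (gauss 1 z 0) * iexp (z \<bullet> u)) \<partial>lborel)"
    by (simp add: Re_exp)
  also have "\<dots> = Re (\<integral>z. complex_of_real (gauss 1 z 0) * iexp (z \<bullet> u) \<partial>lborel)"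
    by (rule integral_Re[OF int])
  finally show ?thesis unfolding eq by simp
qed

text \<open>The kernel as a superposition of waves of frequency \<open>z /\<^sub>R e\<close>.
  Scaling the frequency keeps the weight equal to the standard Gaussian for every
  \<open>e\<close>.\<close>

lemma gauss_eq_integral_cos:
  fixes x y :: "'a::euclidean_space"
  assumes "0 < e"
  shows "gauss e y x = (1 / sqrt (2 * pi * e\<^sup>2)) ^ DIM('a) * (\<integral>z. gauss 1 z 0 * cos ((z /\<^sub>R e) \<bullet> (x - y)) \<partial>lborel)"
proof -
  have "(\<integral>z. gauss 1 z 0 * cos ((z /\<^sub>R e) \<bullet> (x - y)) \<partial>lborel) = (\<integral>z. gauss 1 z 0 * cos (z \<bullet> ((x - y) /\<^sub>R e)) \<partial>lborel)"
    by simp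
  also have "\<dots> = exp (- (dist x y)\<^sup>2 / (2 * e\<^sup>2))"
    unfolding integral_gauss_cos using assms by (simp add: dist_norm power_mult_distrib divide_simps)
  finally show ?thesis by (simp add: gauss_def)
qed

section \<open>Bounds from one-dimensional duality\<close>

abbreviation SWpp :: "real \<Rightarrow> 'a::euclidean_space measure \<Rightarrow> 'a measure \<Rightarrow> ennreal" where
  "SWpp p \<mu> \<nu> \<equiv> \<integral>\<^sup>+ \<theta>. ennreal (Wasserstein p (proj \<mu> \<theta>) (proj \<nu> \<theta>) powr p) \<partial>sphere_unif"

abbreviation tail_moment :: "real \<Rightarrow> real \<Rightarrow> 'a::euclidean_space measure \<Rightarrow> ennreal" where
  "tail_moment p R \<mu> \<equiv> \<integral>\<^sup>+ x. ennreal (norm x powr p) * indicator {x. R < norm x} x \<partial>\<mu>"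

text \<open>The easy half of Kantorovich duality: integrate the pointwise inequality against an
  arbitrary coupling. Subtraction of extended reals is meaningful here because the subtrahend is
  finite.\<close>

lemma Wpp_ge_duality:
  fixes \<alpha> \<beta> :: "'a::euclidean_space measure"
  assumes [measurable]: "f \<in> borel_measurable borel" "h \<in> borel_measurable borel"
    and le: "\<And>u v. f u \<le> h v + K * ennreal (dist u v powr p)" and K: "0 < K"
    and fin: "(\<integral>\<^sup>+ v. h v \<partial>\<beta>) < \<infinity>"
  shows "((\<integral>\<^sup>+ u. f u \<partial>\<alpha>) - (\<integral>\<^sup>+ v. h v \<partial>\<beta>)) / K \<le> Wpp p \<alpha> \<beta>"
  unfolding Wpp_def
proof (rule INF_greatest)
  fix \<pi> assume \<pi>: "\<pi> \<in> couplings \<alpha> \<beta>"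
  note P = couplingsD[OF \<pi>]
  note [measurable_cong] = P(2)
  have "(\<integral>\<^sup>+ u. f u \<partial>\<alpha>) = (\<integral>\<^sup>+ z. f (fst z) \<partial>\<pi>)"
    unfolding P(3)[symmetric] by (subst nn_integral_distr) auto
  also have "\<dots> \<le> (\<integral>\<^sup>+ z. h (snd z) + K * ennreal (dist (fst z) (snd z) powr p) \<partial>\<pi>)"
    by (intro nn_integral_mono le)
  also have "\<dots> = (\<integral>\<^sup>+ z. h (snd z) \<partial>\<pi>) + K * (\<integral>\<^sup>+ z. ennreal (dist (fst z) (snd z) powr p) \<partial>\<pi>)"
    by (simp add: nn_integral_add nn_integral_cmult)
  also have "(\<integral>\<^sup>+ z. h (snd z) \<partial>\<pi>) = (\<integral>\<^sup>+ v. h v \<partial>\<beta>)"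
    unfolding P(4)[symmetric] by (subst nn_integral_distr) auto
  finally have "(\<integral>\<^sup>+ u. f u \<partial>\<alpha>) - (\<integral>\<^sup>+ v. h v \<partial>\<beta>) \<le> K * (\<integral>\<^sup>+ z. ennreal (dist (fst z) (snd z) powr p) \<partial>\<pi>)"
    using fin by (auto simp: ennreal_minus_le_iff)
  then show "((\<integral>\<^sup>+ u. f u \<partial>\<alpha>) - (\<integral>\<^sup>+ v. h v \<partial>\<beta>)) / K \<le> (\<integral>\<^sup>+ z. ennreal (dist (fst z) (snd z) powr p) \<partial>\<pi>)"
    using K by (intro divide_le_posI_ennreal)
qed

lemma nn_integral_proj:
  assumes "sets \<mu> = sets borel" and [measurable]: "f \<in> borel_measurable borel"
  shows "(\<integral>\<^sup>+ u. f u \<partial>proj \<mu> \<theta>) = (\<integral>\<^sup>+ x. f (x \<bullet> \<theta>) \<partial>\<mu>)"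
proof -
  note [measurable_cong] = assms(1)
  show ?thesis unfolding proj_def by (rule nn_integral_distr) measurable
qed

text \<open>The gateway from directionwise lower bounds to \<open>SW\<close>: almost every direction
  lies on the sphere, and there the integrand of \<open>SW\<close> is exactly
  \<open>Wpp\<close>.\<close>

lemma nn_integral_sphere_unif_le_SWpp:
  fixes \<mu> \<nu> :: "'a::euclidean_space measure"
  assumes p: "0 < p" and \<mu>: "\<mu> \<in> P_p p" and \<nu>: "\<nu> \<in> P_p p"
    and le: "\<And>\<theta>. \<theta> \<in> sphere 0 1 \<Longrightarrow> f \<theta> \<le> Wpp p (proj \<mu> \<theta>) (proj \<nu> \<theta>)"
  shows "(\<integral>\<^sup>+ \<theta>. f \<theta> \<partial>sphere_unif) \<le> SWpp p \<mu> \<nu>"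
proof (rule nn_integral_mono_AE)
  show "AE \<theta> in sphere_unif. f \<theta> \<le> ennreal (Wasserstein p (proj \<mu> \<theta>) (proj \<nu> \<theta>) powr p)"
    using AE_sphere_unif
    by eventually_elim (use p in \<open>simp add: le ennreal_Wasserstein_powr proj_in_P_p[OF _ \<mu>] proj_in_P_p[OF _ \<nu>]\<close>)
qed

lemma nn_integral_sphere_unif:
  assumes [measurable]: "f \<in> borel_measurable borel"
  shows "(\<integral>\<^sup>+ \<theta>. f \<theta> \<partial>(sphere_unif :: 'a::euclidean_space measure))
    = (\<integral>\<^sup>+ z. f (z /\<^sub>R norm z) * indicator (ball 0 1) z \<partial>lborel) / emeasure lborel (ball (0::'a) 1)"
  unfolding sphere_unif_def
  by (subst nn_integral_distr) (auto simp: nn_integral_uniform_measure)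

text \<open>Every point of the ball of radius \<open>1/4\<close> around \<open>(3/4) x / norm x\<close> projects to a direction \<open>\<theta>\<close>
  with \<open>\<bar>x \<bullet> \<theta>\<bar> \<ge> norm x / 2\<close>.\<close>

lemma nn_integral_sphere_unif_ge:
  fixes x :: "'a::euclidean_space"
  assumes F[measurable]: "F \<in> borel_measurable borel" and mono: "\<And>s t. s \<le> t \<Longrightarrow> F s \<le> (F t :: ennreal)"
    and x: "x \<noteq> 0"
  shows "F (norm x / 2) * ennreal ((1 / 4) ^ DIM('a)) \<le> (\<integral>\<^sup>+ \<theta>. F \<bar>x \<bullet> \<theta>\<bar> \<partial>sphere_unif)"
proof -
  \<comment> \<open>Since 3/4 + 1/4 = 1 the ball stays inside the unit ball, and 3/4 - 1/4 = 1/2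
    bounds the inner product; its share of the volume is \<open>(1 / 4) ^ DIM('a)\<close>.
    Normalizing a vector of norm below 1 only enlarges the inner product.\<close>
  let ?B = "ball ((3 / 4 / norm x) *\<^sub>R x) (1 / 4)" and ?b = "ball (0::'a) 1"
  have key: "F (norm x / 2) * indicator ?B z \<le> F \<bar>x \<bullet> (z /\<^sub>R norm z)\<bar> * indicator ?b z" for z
  proof (cases "z \<in> ?B")
    case True
    define w where "w = z - (3 / 4 / norm x) *\<^sub>R x"
    have w: "norm w < 1 / 4" using True by (simp add: w_def dist_norm norm_minus_commute)
    have z: "z = (3 / 4 / norm x) *\<^sub>R x + w" by (simp add: w_def)
    have "norm z \<le> 3 / 4 + norm w"
      unfolding z using x norm_triangle_ineq[of "(3 / 4 / norm x) *\<^sub>R x" w] by simp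
    with w have z1: "norm z < 1" by simp
    have "\<bar>x \<bullet> w\<bar> \<le> norm x * (1 / 4)"
      using Cauchy_Schwarz_ineq2[of x w] w mult_left_mono[of "norm w" "1 / 4" "norm x"] by simp
    moreover have "x \<bullet> z = 3 / 4 * norm x + x \<bullet> w"
      unfolding z using x by (simp add: inner_add_right dot_square_norm power2_eq_square)
    ultimately have xz: "norm x / 2 \<le> x \<bullet> z" by (simp add: abs_le_iff)
    then have "z \<noteq> 0" using x by auto
    have "norm x / 2 \<le> \<bar>x \<bullet> z\<bar>" using xz by simp
    also have "\<dots> \<le> \<bar>x \<bullet> z\<bar> / norm z"
      using z1 \<open>z \<noteq> 0\<close> by (simp add: pos_le_divide_eq mult_left_le)
    also have "\<dots> = \<bar>x \<bullet> (z /\<^sub>R norm z)\<bar>" by (simp add: abs_mult divide_inverse mult.commute)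
    finally show ?thesis using True z1 by (auto intro: mono)
  qed simp
  have "F (norm x / 2) * emeasure lborel ?B = (\<integral>\<^sup>+ z. F (norm x / 2) * indicator ?B z \<partial>lborel)"
    by (subst nn_integral_cmult_indicator) auto
  also have "\<dots> \<le> (\<integral>\<^sup>+ z. F \<bar>x \<bullet> (z /\<^sub>R norm z)\<bar> * indicator ?b z \<partial>lborel)"
    by (intro nn_integral_mono key)
  finally have "F (norm x / 2) * emeasure lborel ?B / emeasure lborel ?b \<le> (\<integral>\<^sup>+ \<theta>. F \<bar>x \<bullet> \<theta>\<bar> \<partial>sphere_unif)"
    by (subst nn_integral_sphere_unif) (auto intro: divide_right_mono_ennreal)
  moreover have "emeasure lborel ?B / emeasure lborel ?b = ennreal ((1 / 4) ^ DIM('a))"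
    using unit_ball_vol_pos[of "real DIM('a)"]
    by (simp add: emeasure_ball divide_ennreal del: unit_ball_vol_pos)
  ultimately show ?thesis by (simp add: ennreal_times_divide[symmetric])
qed

text \<open>The test function \<open>\<phi>\<close> vanishes up to \<open>M\<close> and satisfies a
  duality inequality with factor \<open>2 powr p\<close>. For \<open>norm x > 4 * M\<close> one has
  \<open>norm x / 2 - M > norm x / 4\<close>, so \<open>\<phi> (norm x / 2)\<close> is at least
  \<open>(norm x / 4) powr p\<close>, and a share \<open>(1 / 4) ^ DIM('a)\<close> of the directions
  sees at least \<open>norm x / 2\<close>. The losses multiply to
  \<open>4 ^ DIM('a) * 4 powr p * 2 powr p\<close>.\<close>

lemma tail_moment_le:
  fixes \<mu> \<nu> :: "'a::euclidean_space measure"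
  assumes p: "0 < p" and \<mu>: "\<mu> \<in> P_p p" and \<nu>: "\<nu> \<in> P_p p" and M: "0 \<le> M"
  shows "tail_moment p (4 * M) \<mu> \<le> ennreal (4 ^ DIM('a) * 8 powr p) * (SWpp p \<mu> \<nu> + tail_moment p M \<nu>)"
proof -
  note m = P_pD[OF \<mu>] and n = P_pD[OF \<nu>]
  note [measurable_cong] = m(2) n(2)
  interpret \<mu>: prob_space \<mu> by fact
  interpret \<nu>: prob_space \<nu> by fact
  interpret \<sigma>: prob_space "sphere_unif :: 'a measure" by (rule prob_space_sphere_unif)
  interpret pair_sigma_finite "sphere_unif :: 'a measure" \<mu> ..
  have [measurable_cong]: "sets (sphere_unif :: 'a measure) = sets borel" by (simp add: sphere_unif_def)
  define \<phi> :: "real \<Rightarrow> real" where "\<phi> t = max 0 (t - M) powr p" for t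
  have [measurable]: "\<phi> \<in> borel_measurable borel" unfolding \<phi>_def by measurable
  have \<phi>_mono: "\<phi> s \<le> \<phi> t" if "s \<le> t" for s t
    unfolding \<phi>_def using that p by (intro powr_mono2) auto
  \<comment> \<open>A bound for the projected tail of \<open>\<nu>\<close> that does not depend on
    the direction; being finite, it may be subtracted.\<close>
  let ?c = "ennreal (2 powr p) * tail_moment p M \<nu>"
  have "tail_moment p M \<nu> \<le> (\<integral>\<^sup>+ x. ennreal (norm x powr p) \<partial>\<nu>)"
    by (intro nn_integral_mono) (auto split: split_indicator)
  with n(4) have c_fin: "?c < \<infinity>" by (auto simp: ennreal_mult_less_top)
  let ?T = "\<lambda>\<theta>. \<integral>\<^sup>+ x. ennreal (\<phi> \<bar>x \<bullet> \<theta>\<bar>) \<partial>\<mu>"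
  have "(?T \<theta> - ?c) / ennreal (2 powr p) \<le> Wpp p (proj \<mu> \<theta>) (proj \<nu> \<theta>)" if \<theta>: "\<theta> \<in> sphere 0 1" for \<theta>
  proof -
    have dual: "ennreal (\<phi> \<bar>u\<bar>) \<le> ennreal (2 powr p) * ennreal (\<phi> \<bar>v\<bar>) + ennreal (2 powr p) * ennreal (dist u v powr p)" for u v :: real
    proof -
      have "\<phi> \<bar>u\<bar> \<le> (max 0 (\<bar>v\<bar> - M) + \<bar>u - v\<bar>) powr p"
        unfolding \<phi>_def using p by (intro powr_mono2) auto
      also have "\<dots> \<le> 2 powr p * (max 0 (\<bar>v\<bar> - M) powr p + \<bar>u - v\<bar> powr p)"
        by (rule powr_add_le) (use p in auto)
      finally show ?thesis
        unfolding \<phi>_def by (simp add: dist_real_def distrib_left[symmetric] ennreal_mult'[symmetric] ennreal_plus[symmetric] del: ennreal_plus)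
    qed
    have "(\<integral>\<^sup>+ u. ennreal (2 powr p) * ennreal (\<phi> \<bar>u\<bar>) \<partial>proj \<nu> \<theta>) = ennreal (2 powr p) * (\<integral>\<^sup>+ x. ennreal (\<phi> \<bar>x \<bullet> \<theta>\<bar>) \<partial>\<nu>)"
      by (subst nn_integral_proj[OF n(2)]) (auto intro: nn_integral_cmult)
    also have "\<dots> \<le> ?c"
    proof (intro mult_left_mono nn_integral_mono)
      fix x :: 'a
      have "\<bar>x \<bullet> \<theta>\<bar> \<le> norm x" using Cauchy_Schwarz_ineq2[of x \<theta>] \<theta> by simp
      then have "\<phi> \<bar>x \<bullet> \<theta>\<bar> \<le> \<phi> (norm x)" by (rule \<phi>_mono)
      also have "\<dots> \<le> norm x powr p * indicator {x. M < norm x} x"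
        unfolding \<phi>_def using p M by (auto simp: indicator_def max_def intro!: powr_mono2)
      finally show "ennreal (\<phi> \<bar>x \<bullet> \<theta>\<bar>) \<le> ennreal (norm x powr p) * indicator {x. M < norm x} x"
        by (auto simp: indicator_def ennreal_neg split: if_splits)
    qed simp
    finally have hc: "(\<integral>\<^sup>+ u. ennreal (2 powr p) * ennreal (\<phi> \<bar>u\<bar>) \<partial>proj \<nu> \<theta>) \<le> ?c" .
    then have "(?T \<theta> - ?c) \<le> ?T \<theta> - (\<integral>\<^sup>+ u. ennreal (2 powr p) * ennreal (\<phi> \<bar>u\<bar>) \<partial>proj \<nu> \<theta>)"
      by (rule ennreal_minus_mono[OF order_refl])
    also have "\<dots> = (\<integral>\<^sup>+ u. ennreal (\<phi> \<bar>u\<bar>) \<partial>proj \<mu> \<theta>) - (\<integral>\<^sup>+ u. ennreal (2 powr p) * ennreal (\<phi> \<bar>u\<bar>) \<partial>proj \<nu> \<theta>)"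
      by (subst nn_integral_proj[OF m(2)]) auto
    finally have "(?T \<theta> - ?c) / ennreal (2 powr p) \<le> ((\<integral>\<^sup>+ u. ennreal (\<phi> \<bar>u\<bar>) \<partial>proj \<mu> \<theta>) - (\<integral>\<^sup>+ u. ennreal (2 powr p) * ennreal (\<phi> \<bar>u\<bar>) \<partial>proj \<nu> \<theta>)) / ennreal (2 powr p)"
      by (rule divide_right_mono_ennreal)
    also have "\<dots> \<le> Wpp p (proj \<mu> \<theta>) (proj \<nu> \<theta>)"
      by (rule Wpp_ge_duality[OF _ _ dual]) (use hc c_fin in \<open>auto intro: order_le_less_trans\<close>)
    finally show ?thesis .
  qed
  then have S: "(\<integral>\<^sup>+ \<theta>. (?T \<theta> - ?c) / ennreal (2 powr p) \<partial>sphere_unif) \<le> SWpp p \<mu> \<nu>"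
    by (rule nn_integral_sphere_unif_le_SWpp[OF p \<mu> \<nu>])
  \<comment> \<open>Truncated subtraction: when \<open>c\<close> exceeds \<open>t\<close> the right
    side is \<open>c\<close>, so equality can fail.\<close>
  have aux: "t \<le> t - c + c" for t c :: ennreal
    using ennreal_minus_le_iff[of t c "t - c"] by (simp add: add.commute)
  have "(\<integral>\<^sup>+ \<theta>. ?T \<theta> \<partial>sphere_unif) \<le> (\<integral>\<^sup>+ \<theta>. ennreal (2 powr p) * ((?T \<theta> - ?c) / ennreal (2 powr p)) + ?c \<partial>sphere_unif)"
  proof (rule nn_integral_mono)
    fix \<theta> :: 'a
    have "ennreal (2 powr p) * ((?T \<theta> - ?c) / ennreal (2 powr p)) = ?T \<theta> - ?c"
      by (subst ennreal_times_divide, subst mult.commute, rule mult_divide_eq_ennreal) auto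
    moreover have "?T \<theta> \<le> ?T \<theta> - ?c + ?c"
      by (rule aux)
    ultimately show "?T \<theta> \<le> ennreal (2 powr p) * ((?T \<theta> - ?c) / ennreal (2 powr p)) + ?c" by simp
  qed
  also have "\<dots> = ennreal (2 powr p) * (\<integral>\<^sup>+ \<theta>. (?T \<theta> - ?c) / ennreal (2 powr p) \<partial>sphere_unif) + ?c"
    by (subst nn_integral_add) (auto simp: nn_integral_cmult \<sigma>.emeasure_space_1)
  also have "\<dots> \<le> ennreal (2 powr p) * SWpp p \<mu> \<nu> + ?c"
    by (intro add_right_mono mult_left_mono S) auto
  also have "\<dots> = ennreal (2 powr p) * (SWpp p \<mu> \<nu> + tail_moment p M \<nu>)"
    by (simp add: distrib_left)
  finally have upper: "(\<integral>\<^sup>+ \<theta>. ?T \<theta> \<partial>sphere_unif) \<le> ennreal (2 powr p) * (SWpp p \<mu> \<nu> + tail_moment p M \<nu>)" .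
  have lower: "ennreal (norm x powr p) * indicator {x. 4 * M < norm x} x
      \<le> ennreal (4 ^ DIM('a) * 4 powr p) * (\<integral>\<^sup>+ \<theta>. ennreal (\<phi> \<bar>x \<bullet> \<theta>\<bar>) \<partial>sphere_unif)" for x :: 'a
  proof (cases "4 * M < norm x")
    case True
    then have x: "x \<noteq> 0" using M by auto
    have "(norm x / 4) powr p \<le> \<phi> (norm x / 2)"
      unfolding \<phi>_def using True p M by (intro powr_mono2) (auto simp: max_def)
    then have "norm x powr p \<le> 4 powr p * \<phi> (norm x / 2)"
      by (simp add: powr_divide field_simps)
    then have "ennreal (norm x powr p) \<le> ennreal (4 ^ DIM('a) * 4 powr p) * (ennreal (\<phi> (norm x / 2)) * ennreal ((1 / 4) ^ DIM('a)))"
      by (simp add: ennreal_mult'[symmetric] \<phi>_def power_one_over)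
    also have "\<dots> \<le> ennreal (4 ^ DIM('a) * 4 powr p) * (\<integral>\<^sup>+ \<theta>. ennreal (\<phi> \<bar>x \<bullet> \<theta>\<bar>) \<partial>sphere_unif)"
      by (intro mult_left_mono nn_integral_sphere_unif_ge x) (auto intro: ennreal_leI \<phi>_mono)
    finally show ?thesis using True by simp
  qed simp
  have "tail_moment p (4 * M) \<mu> \<le> (\<integral>\<^sup>+ x. ennreal (4 ^ DIM('a) * 4 powr p) * (\<integral>\<^sup>+ \<theta>. ennreal (\<phi> \<bar>x \<bullet> \<theta>\<bar>) \<partial>sphere_unif) \<partial>\<mu>)"
    by (intro nn_integral_mono lower)
  also have "\<dots> = ennreal (4 ^ DIM('a) * 4 powr p) * (\<integral>\<^sup>+ x. \<integral>\<^sup>+ \<theta>. ennreal (\<phi> \<bar>x \<bullet> \<theta>\<bar>) \<partial>sphere_unif \<partial>\<mu>)"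
    by (rule nn_integral_cmult) measurable
  also have "(\<integral>\<^sup>+ x. \<integral>\<^sup>+ \<theta>. ennreal (\<phi> \<bar>x \<bullet> \<theta>\<bar>) \<partial>sphere_unif \<partial>\<mu>) = (\<integral>\<^sup>+ \<theta>. ?T \<theta> \<partial>sphere_unif)"
    by (rule Fubini') measurable
  also have "ennreal (4 ^ DIM('a) * 4 powr p) * \<dots> \<le> ennreal (4 ^ DIM('a) * 4 powr p) * (ennreal (2 powr p) * (SWpp p \<mu> \<nu> + tail_moment p M \<nu>))"
    by (intro mult_left_mono upper) auto
  also have "\<dots> = ennreal (4 ^ DIM('a) * 8 powr p) * (SWpp p \<mu> \<nu> + tail_moment p M \<nu>)"
    using powr_mult[of 4 2 p] by (simp add: ennreal_mult'[symmetric] mult.assoc[symmetric])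
  finally show ?thesis .
qed

lemma tail_moment_tendsto_0:
  fixes \<mu> :: "'a::euclidean_space measure"
  assumes \<mu>: "\<mu> \<in> P_p p"
  shows "(\<lambda>k. tail_moment p (real k) \<mu>) \<longlonglongrightarrow> 0"
proof -
  note m = P_pD[OF \<mu>]
  note [measurable_cong] = m(2)
  have "(\<lambda>k. tail_moment p (real k) \<mu>) \<longlonglongrightarrow> (\<integral>\<^sup>+ x. 0 \<partial>\<mu>)"
  proof (rule nn_integral_dominated_convergence[where w="\<lambda>x. ennreal (norm x powr p)"])
    show "AE x in \<mu>. (\<lambda>k. ennreal (norm x powr p) * indicator {x. real k < norm x} x) \<longlonglongrightarrow> 0"
    proof (rule AE_I2)
      fix x :: 'a
      have "\<forall>\<^sub>F k in sequentially. norm x \<le> real k"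
        using filterlim_real_sequentially by (auto simp: filterlim_at_top)
      then have "\<forall>\<^sub>F k in sequentially. ennreal (norm x powr p) * indicator {x. real k < norm x} x = 0"
        by eventually_elim auto
      then show "(\<lambda>k. ennreal (norm x powr p) * indicator {x. real k < norm x} x) \<longlonglongrightarrow> 0"
        by (rule tendsto_eventually)
    qed
  qed (use m(4) in \<open>auto split: split_indicator\<close>)
  then show ?thesis by simp
qed

section \<open>Differences of characteristic functions\<close>

text \<open>The real part of the difference of characteristic functions after translating
  \<open>y\<close> to the origin. The sign is \<open>\<nu>\<close> minus \<open>\<mu>\<close>
  because the overlap of the smoothed densities depends only on the positive part of that
  difference.\<close>

definition cos_diff :: "'a::euclidean_space measure \<Rightarrow> 'a measure \<Rightarrow> 'a \<Rightarrow> 'a \<Rightarrow> real" where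
  "cos_diff \<mu> \<nu> y \<xi> = (\<integral>x. cos (\<xi> \<bullet> (x - y)) \<partial>\<nu>) - (\<integral>x. cos (\<xi> \<bullet> (x - y)) \<partial>\<mu>)"

text \<open>Continuity in the frequency feeds the semicontinuity of \<open>ray_sup\<close>.\<close>

lemma continuous_on_integral_cos:
  fixes \<mu> :: "'a::euclidean_space measure"
  assumes \<mu>: "prob_space \<mu>" "sets \<mu> = sets borel"
  shows "continuous_on UNIV (\<lambda>\<xi>. \<integral>x. cos (\<xi> \<bullet> (x - y)) \<partial>\<mu>)"
proof -
  note [measurable_cong] = \<mu>(2)
  interpret prob_space \<mu> by fact
  show ?thesis
    unfolding continuous_on_sequentially
  proof (intro allI impI ballI)
    fix u :: "nat \<Rightarrow> 'a" and a assume "(\<forall>n. u n \<in> UNIV) \<and> u \<longlonglongrightarrow> a"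
    then have u: "u \<longlonglongrightarrow> a" by simp
    show "((\<lambda>\<xi>. \<integral>x. cos (\<xi> \<bullet> (x - y)) \<partial>\<mu>) \<circ> u) \<longlonglongrightarrow> (\<integral>x. cos (a \<bullet> (x - y)) \<partial>\<mu>)"
      unfolding o_def
      by (rule integral_dominated_convergence[where w="\<lambda>_. 1"])
        (auto intro!: tendsto_intros u)
  qed
qed

lemma continuous_on_cos_diff:
  fixes \<mu> \<nu> :: "'a::euclidean_space measure"
  assumes "prob_space \<mu>" "sets \<mu> = sets borel" "prob_space \<nu>" "sets \<nu> = sets borel"
  shows "continuous_on UNIV (cos_diff \<mu> \<nu> y)"
  unfolding cos_diff_def[abs_def] by (intro continuous_on_diff continuous_on_integral_cos assms)

lemma integral_cos_le_1:
  fixes \<mu> :: "'a::euclidean_space measure" and f :: "'a \<Rightarrow> real"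
  assumes "prob_space \<mu>"
  shows "\<bar>\<integral>x. cos (f x) \<partial>\<mu>\<bar> \<le> 1"
proof -
  interpret prob_space \<mu> by fact
  have "\<bar>\<integral>x. cos (f x) \<partial>\<mu>\<bar> \<le> (\<integral>x. \<bar>cos (f x)\<bar> \<partial>\<mu>)"
    using integral_norm_bound[of \<mu> "\<lambda>x. cos (f x)"] by simp
  also have "\<dots> \<le> (\<integral>x. 1 \<partial>\<mu>)"
    by (rule integral_mono') auto
  finally show ?thesis by (simp add: prob_space)
qed

lemma cos_diff_le_2:
  assumes "prob_space \<mu>" "prob_space \<nu>"
  shows "cos_diff \<mu> \<nu> y \<xi> \<le> 2"
  using integral_cos_le_1[OF assms(1), of "\<lambda>x. \<xi> \<bullet> (x - y)"] integral_cos_le_1[OF assms(2), of "\<lambda>x. \<xi> \<bullet> (x - y)"]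
  unfolding cos_diff_def by linarith

lemma abs_cos_diff_le: "\<bar>cos a - cos b\<bar> \<le> \<bar>a - b\<bar>" for a b :: real
proof -
  have "\<bar>cos a - cos b\<bar> = 2 * \<bar>sin ((a + b) / 2)\<bar> * \<bar>sin ((b - a) / 2)\<bar>"
    by (simp add: cos_diff_cos abs_mult)
  also have "\<dots> \<le> 2 * 1 * \<bar>(b - a) / 2\<bar>"
    by (intro mult_mono abs_sin_x_le_abs_x) auto
  finally show ?thesis by simp
qed

text \<open>Trades a first power for a \<open>p\<close>-th power, since the cosine is Lipschitz
  while \<open>Wpp\<close> has cost of order \<open>p\<close>. Above \<open>\<delta>\<close> the
  factor \<open>t powr (1 - p)\<close> is decreasing because \<open>p \<ge> 1\<close>.\<close>

lemma le_delta_plus_powr: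
  fixes t \<delta> p :: real
  assumes "0 < \<delta>" "1 \<le> p" "0 \<le> t"
  shows "t \<le> \<delta> + \<delta> powr (1 - p) * t powr p"
proof (cases "t \<le> \<delta>")
  case True
  then show ?thesis by (simp add: add_increasing2)
next
  case False
  then have t: "0 < t" using assms by simp
  have "t = t powr (1 - p) * t powr p" using t by (simp add: powr_add[symmetric])
  also have "t powr (1 - p) \<le> \<delta> powr (1 - p)"
    using False assms by (intro powr_mono2') auto
  finally have "t \<le> \<delta> powr (1 - p) * t powr p" by (simp add: mult_right_mono)
  then show ?thesis using assms by linarith
qed

text \<open>Duality with the wave \<open>1 - cos\<close>, shifted by 1 to be nonnegative. It has
  Lipschitz constant \<open>r\<close>; by \<open>le_delta_plus_powr\<close> this costs an additive
  \<open>r * \<delta>\<close> and the multiplier \<open>K = r * \<delta> powr (1 - p)\<close>, and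
  division by \<open>K\<close> leaves the stated bound.\<close>

lemma cos_diff_le_Wpp:
  fixes \<mu> \<nu> :: "'a::euclidean_space measure"
  assumes \<mu>: "prob_space \<mu>" "sets \<mu> = sets borel" and \<nu>: "prob_space \<nu>" "sets \<nu> = sets borel"
    and p: "1 \<le> p" and r: "0 < r" and \<delta>: "0 < \<delta>"
  shows "ennreal ((cos_diff \<mu> \<nu> y (r *\<^sub>R \<theta>) / r - \<delta>) * \<delta> powr (p - 1)) \<le> Wpp p (proj \<mu> \<theta>) (proj \<nu> \<theta>)"
proof -
  define f where "f u = 1 - cos (r * (u - y \<bullet> \<theta>))" for u
  have f[measurable]: "f \<in> borel_measurable borel" unfolding f_def by measurable
  have f0: "0 \<le> f u" for u unfolding f_def by simp
  define K where "K = r * \<delta> powr (1 - p)"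
  have K: "0 < K" using r \<delta> by (simp add: K_def)
  have dual: "ennreal (f u) \<le> ennreal (f v + r * \<delta>) + ennreal K * ennreal (dist u v powr p)" for u v
  proof -
    have "f u \<le> f v + r * \<bar>u - v\<bar>"
      using abs_cos_diff_le[of "r * (u - y \<bullet> \<theta>)" "r * (v - y \<bullet> \<theta>)"] r
      by (simp add: f_def right_diff_distrib[symmetric] abs_mult)
    also have "\<dots> \<le> f v + r * (\<delta> + \<delta> powr (1 - p) * \<bar>u - v\<bar> powr p)"
      using r \<delta> p by (intro add_left_mono mult_left_mono le_delta_plus_powr) auto
    also have "\<dots> = (f v + r * \<delta>) + K * dist u v powr p"
      by (simp add: K_def dist_real_def algebra_simps)
    finally show ?thesis
      using f0[of v] r \<delta> K by (simp add: ennreal_mult'[symmetric] ennreal_plus[symmetric] del: ennreal_plus)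
  qed
  have int: "(\<integral>\<^sup>+ u. ennreal (f u + c) \<partial>proj \<alpha> \<theta>) = ennreal (1 - (\<integral>x. cos ((r *\<^sub>R \<theta>) \<bullet> (x - y)) \<partial>\<alpha>) + c)"
    if \<alpha>: "prob_space \<alpha>" "sets \<alpha> = sets borel" and c: "0 \<le> c" for \<alpha> c
  proof -
    note [measurable_cong] = \<alpha>(2)
    interpret prob_space \<alpha> by fact
    have i: "integrable \<alpha> (\<lambda>x. cos (r * (x \<bullet> \<theta> - y \<bullet> \<theta>)))"
      by (rule integrable_const_bound[where B=1]) auto
    have "(\<integral>\<^sup>+ u. ennreal (f u + c) \<partial>proj \<alpha> \<theta>) = (\<integral>\<^sup>+ x. ennreal (f (x \<bullet> \<theta>) + c) \<partial>\<alpha>)"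
      by (rule nn_integral_proj) (use \<alpha> in auto)
    also have "\<dots> = ennreal (\<integral>x. f (x \<bullet> \<theta>) + c \<partial>\<alpha>)"
      unfolding f_def using c i by (intro nn_integral_eq_integral) (auto intro!: AE_I2 add_nonneg_nonneg)
    also have "(\<integral>x. f (x \<bullet> \<theta>) + c \<partial>\<alpha>) = 1 - (\<integral>x. cos (r * (x \<bullet> \<theta> - y \<bullet> \<theta>)) \<partial>\<alpha>) + c"
      unfolding f_def using i by (simp add: prob_space)
    also have "(\<lambda>x. cos (r * (x \<bullet> \<theta> - y \<bullet> \<theta>))) = (\<lambda>x. cos ((r *\<^sub>R \<theta>) \<bullet> (x - y)))"
      by (simp add: inner_diff_left inner_commute[of \<theta>])
    finally show ?thesis .
  qed
  let ?A = "\<lambda>\<alpha>. \<integral>x. cos ((r *\<^sub>R \<theta>) \<bullet> (x - y)) \<partial>\<alpha>"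
  have "((\<integral>\<^sup>+ u. ennreal (f u) \<partial>proj \<mu> \<theta>) - (\<integral>\<^sup>+ v. ennreal (f v + r * \<delta>) \<partial>proj \<nu> \<theta>)) / ennreal K \<le> Wpp p (proj \<mu> \<theta>) (proj \<nu> \<theta>)"
    by (rule Wpp_ge_duality[OF _ _ dual]) (use K r \<delta> in \<open>auto simp: int[OF \<nu>]\<close>)
  also have "(\<integral>\<^sup>+ u. ennreal (f u) \<partial>proj \<mu> \<theta>) = ennreal (1 - ?A \<mu>)"
    using int[OF \<mu>, of 0] by simp
  also have "(\<integral>\<^sup>+ v. ennreal (f v + r * \<delta>) \<partial>proj \<nu> \<theta>) = ennreal (1 - ?A \<nu> + r * \<delta>)"
    by (rule int[OF \<nu>]) (use r \<delta> in auto)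
  also have "ennreal (1 - ?A \<mu>) - ennreal (1 - ?A \<nu> + r * \<delta>) = ennreal (cos_diff \<mu> \<nu> y (r *\<^sub>R \<theta>) - r * \<delta>)"
  proof -
    have "0 \<le> r * \<delta>" using r \<delta> by simp
    then have "0 \<le> 1 - ?A \<nu> + r * \<delta>"
      using integral_cos_le_1[OF \<nu>(1), of "\<lambda>x. (r *\<^sub>R \<theta>) \<bullet> (x - y)"] by linarith
    then show ?thesis by (subst ennreal_minus) (auto simp: cos_diff_def intro!: arg_cong[where f=ennreal])
  qed
  also have "\<dots> / ennreal K = ennreal ((cos_diff \<mu> \<nu> y (r *\<^sub>R \<theta>) / r - \<delta>) * \<delta> powr (p - 1))"
  proof -
    have e: "(cos_diff \<mu> \<nu> y (r *\<^sub>R \<theta>) - r * \<delta>) / K = (cos_diff \<mu> \<nu> y (r *\<^sub>R \<theta>) / r - \<delta>) * \<delta> powr (p - 1)"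
      using r \<delta> powr_minus[of \<delta> "p - 1"] by (simp add: K_def field_simps)
    \<comment> \<open>For a negative numerator \<open>ennreal\<close> truncates both sides to
      0.\<close>
    show ?thesis
    proof (cases "0 \<le> cos_diff \<mu> \<nu> y (r *\<^sub>R \<theta>) - r * \<delta>")
      case True
      then show ?thesis using K by (simp add: divide_ennreal e)
    next
      case False
      then have "(cos_diff \<mu> \<nu> y (r *\<^sub>R \<theta>) - r * \<delta>) / K \<le> 0"
        using K by (intro divide_nonpos_nonneg) auto
      then show ?thesis using False K unfolding e by (simp add: ennreal_neg)
    qed
  qed
  finally show ?thesis .
qed

text \<open>The supremum over all radii \<open>r\<close> bounds the difference of the characteristic functions along whole
  rays by a function of the direction alone. It is lower semicontinuous, hence measurable.\<close>

definition ray_sup :: "real \<Rightarrow> real \<Rightarrow> 'a::euclidean_space measure \<Rightarrow> 'a measure \<Rightarrow> 'a \<Rightarrow> 'a \<Rightarrow> ennreal" where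
  "ray_sup p \<delta> \<mu> \<nu> y \<theta> = (SUP r\<in>{0<..}. ennreal ((cos_diff \<mu> \<nu> y (r *\<^sub>R \<theta>) / r - \<delta>) * \<delta> powr (p - 1)))"

lemma measurable_ray_sup:
  fixes \<mu> \<nu> :: "'a::euclidean_space measure"
  assumes "prob_space \<mu>" "sets \<mu> = sets borel" "prob_space \<nu>" "sets \<nu> = sets borel"
  shows "ray_sup p \<delta> \<mu> \<nu> y \<in> borel_measurable borel"
proof (rule borel_measurableI_greater)
  fix a :: ennreal
  \<comment> \<open>The union over \<open>r\<close> is uncountable, so measurability comes from each
    of the sets being open.\<close>
  have "{\<theta>. a < ray_sup p \<delta> \<mu> \<nu> y \<theta>}
      = (\<Union>r\<in>{0<..}. {\<theta>. a < ennreal ((cos_diff \<mu> \<nu> y (r *\<^sub>R \<theta>) / r - \<delta>) * \<delta> powr (p - 1))})"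
    by (auto simp: ray_sup_def less_SUP_iff)
  moreover have "open {\<theta>. a < ennreal ((cos_diff \<mu> \<nu> y (r *\<^sub>R \<theta>) / r - \<delta>) * \<delta> powr (p - 1))}" if "0 < r" for r
  proof -
    have "continuous_on UNIV (\<lambda>\<theta>. cos_diff \<mu> \<nu> y (r *\<^sub>R \<theta>))"
      by (rule continuous_on_compose2[OF continuous_on_cos_diff[OF assms]]) (auto intro!: continuous_intros)
    then show ?thesis
      using that by (intro open_Collect_less continuous_on_const continuous_on_ennreal continuous_on_mult
          continuous_on_diff continuous_on_divide) auto
  qed
  ultimately show "{\<theta> \<in> space borel. a < ray_sup p \<delta> \<mu> \<nu> y \<theta>} \<in> sets borel"
    by (auto intro!: borel_open open_UN)
qed

text \<open>The bound in \<open>cos_diff_le_Wpp\<close> does not depend on \<open>r\<close>, so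
  passing to the supremum along the ray costs nothing.\<close>

lemma nn_integral_ray_sup_le:
  fixes \<mu> \<nu> :: "'a::euclidean_space measure"
  assumes p: "1 \<le> p" and \<mu>: "\<mu> \<in> P_p p" and \<nu>: "\<nu> \<in> P_p p" and \<delta>: "0 < \<delta>"
  shows "(\<integral>\<^sup>+ \<theta>. ray_sup p \<delta> \<mu> \<nu> y \<theta> \<partial>sphere_unif) \<le> SWpp p \<mu> \<nu>"
proof (rule nn_integral_sphere_unif_le_SWpp[OF _ \<mu> \<nu>])
  show "ray_sup p \<delta> \<mu> \<nu> y \<theta> \<le> Wpp p (proj \<mu> \<theta>) (proj \<nu> \<theta>)" for \<theta>
    unfolding ray_sup_def
    by (rule SUP_least, rule cos_diff_le_Wpp) (use p \<delta> P_pD[OF \<mu>] P_pD[OF \<nu>] in auto)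
qed (use p in auto)

text \<open>Write the frequency as radius \<open>norm z / e\<close> times direction and solve the
  expression inside \<open>ray_sup\<close> for \<open>cos_diff\<close>. The radius remains only as a
  linear factor. At \<open>z = 0\<close> there is no direction, but the difference vanishes since
  both masses are 1.\<close>

lemma cos_diff_le_ray_sup:
  fixes \<mu> \<nu> :: "'a::euclidean_space measure"
  assumes "prob_space \<mu>" "prob_space \<nu>" and \<delta>: "0 < \<delta>" and e: "0 < e"
  shows "ennreal (cos_diff \<mu> \<nu> y (z /\<^sub>R e))
    \<le> ennreal (norm z / e) * (ennreal \<delta> + ennreal (\<delta> powr (1 - p)) * ray_sup p \<delta> \<mu> \<nu> y (z /\<^sub>R norm z))"
proof (cases "z = 0")
  case True
  interpret \<mu>: prob_space \<mu> by fact
  interpret \<nu>: prob_space \<nu> by fact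
  show ?thesis using True by (simp add: cos_diff_def \<mu>.prob_space \<nu>.prob_space)
next
  case False
  let ?r = "norm z / e" and ?\<theta> = "z /\<^sub>R norm z"
  have r: "0 < ?r" using False e by simp
  have z: "z /\<^sub>R e = ?r *\<^sub>R ?\<theta>" using False by (simp add: divide_inverse)
  let ?D = "cos_diff \<mu> \<nu> y (z /\<^sub>R e)"
  have le: "ennreal ((?D / ?r - \<delta>) * \<delta> powr (p - 1)) \<le> ray_sup p \<delta> \<mu> \<nu> y ?\<theta>"
    unfolding ray_sup_def z by (rule SUP_upper) (use r in simp)
  have "?D / ?r = \<delta> + \<delta> powr (1 - p) * ((?D / ?r - \<delta>) * \<delta> powr (p - 1))"
  proof -
    have *: "\<delta> powr (1 - p) * (X * \<delta> powr (p - 1)) = X" for X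
      using \<delta> by (simp add: powr_add[symmetric] mult.left_commute[of _ X])
    show ?thesis unfolding * by simp
  qed
  \<comment> \<open>Only an inequality: a negative second summand is truncated to 0 on the
    right.\<close>
  also have "ennreal \<dots> \<le> ennreal \<delta> + ennreal (\<delta> powr (1 - p)) * ennreal ((?D / ?r - \<delta>) * \<delta> powr (p - 1))"
    using \<delta> by (simp add: ennreal_mult'[symmetric] ennreal_plus_if ennreal_leI)
  also have "\<dots> \<le> ennreal \<delta> + ennreal (\<delta> powr (1 - p)) * ray_sup p \<delta> \<mu> \<nu> y ?\<theta>"
    by (intro add_left_mono mult_left_mono le) auto
  finally have "ennreal ?r * ennreal (?D / ?r) \<le> ennreal ?r * (ennreal \<delta> + ennreal (\<delta> powr (1 - p)) * ray_sup p \<delta> \<mu> \<nu> y ?\<theta>)"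
    by (rule mult_left_mono) simp
  moreover have "ennreal ?r * ennreal (?D / ?r) = ennreal ?D"
    using r False e by (simp add: ennreal_mult'[symmetric])
  ultimately show ?thesis by simp
qed

text \<open>Takes the place of polar coordinates: dilation multiplies Lebesgue measure by
  \<open>R ^ DIM('a)\<close> and preserves directions, and on the unit ball the law of the direction
  is \<open>sphere_unif\<close> by definition.\<close>

lemma nn_integral_ball_direction:
  fixes f :: "'a::euclidean_space \<Rightarrow> ennreal"
  assumes [measurable]: "f \<in> borel_measurable borel" and R: "0 < R"
  shows "(\<integral>\<^sup>+ z. f (z /\<^sub>R norm z) * indicator (ball 0 R) z \<partial>lborel)
    = ennreal (R ^ DIM('a)) * emeasure lborel (ball (0::'a) 1) * (\<integral>\<^sup>+ \<theta>. f \<theta> \<partial>sphere_unif)"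
proof -
  have ind: "indicator (ball 0 R) (R *\<^sub>R z) = (indicator (ball 0 1) z :: ennreal)" for z :: 'a
    using R by (auto simp: indicator_def)
  have dir: "(R *\<^sub>R z) /\<^sub>R norm (R *\<^sub>R z) = z /\<^sub>R norm z" for z :: 'a
    using R by simp
  have [measurable]: "Measurable.pred borel (\<lambda>x::'a. x \<in> ball 0 r)" for r
    unfolding mem_ball by measurable
  have mF[measurable]: "(\<lambda>z. f (z /\<^sub>R norm z) * indicator (ball 0 r) z) \<in> borel_measurable borel" for r
    by measurable
  have "(\<integral>\<^sup>+ z. f (z /\<^sub>R norm z) * indicator (ball 0 R) z \<partial>lborel)
      = (\<integral>\<^sup>+ z. f (z /\<^sub>R norm z) * indicator (ball 0 R) z \<partial>density (distr lborel borel (\<lambda>z. 0 + R *\<^sub>R z)) (\<lambda>_. ennreal (\<bar>R\<bar> ^ DIM('a))))"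
    using lborel_affine[of R "0 :: 'a"] R by simp
  also have "\<dots> = (\<integral>\<^sup>+ z. ennreal (R ^ DIM('a)) * (f ((R *\<^sub>R z) /\<^sub>R norm (R *\<^sub>R z)) * indicator (ball 0 R) (R *\<^sub>R z)) \<partial>lborel)"
    using R by (subst nn_integral_density, simp, simp, subst nn_integral_distr) simp_all
  also have "\<dots> = ennreal (R ^ DIM('a)) * (\<integral>\<^sup>+ z. f (z /\<^sub>R norm z) * indicator (ball 0 1) z \<partial>lborel)"
    unfolding dir ind by (rule nn_integral_cmult) measurable
  also have "(\<integral>\<^sup>+ z. f (z /\<^sub>R norm z) * indicator (ball 0 1) z \<partial>lborel) = emeasure lborel (ball (0::'a) 1) * (\<integral>\<^sup>+ \<theta>. f \<theta> \<partial>sphere_unif)"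
  proof -
    have "emeasure lborel (ball (0::'a) 1) \<noteq> 0" "emeasure lborel (ball (0::'a) 1) \<noteq> top"
      using unit_ball_vol_pos[of "real DIM('a)"] by (simp_all add: emeasure_ball del: unit_ball_vol_pos)
    then show ?thesis
      by (subst nn_integral_sphere_unif)
        (auto simp: ennreal_times_divide mult.commute[of "emeasure lborel (ball (0::'a) 1)"] mult_divide_eq_ennreal)
  qed
  finally show ?thesis by (simp add: mult.assoc)
qed

text \<open>High frequencies are handled by the trivial bound 2 and the Gaussian tail. On the ball
  of radius \<open>R\<close> the Gaussian weight is at most 1 and the ray bound applies with radius
  at most \<open>R / e\<close>.\<close>

lemma nn_integral_gauss_cos_diff_le:
  fixes \<mu> \<nu> :: "'a::euclidean_space measure"
  assumes p: "1 \<le> p" and \<mu>: "\<mu> \<in> P_p p" and \<nu>: "\<nu> \<in> P_p p" and \<delta>: "0 < \<delta>" and e: "0 < e" and R: "0 < R"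
  shows "(\<integral>\<^sup>+ z. ennreal (gauss 1 z 0 * cos_diff \<mu> \<nu> y (z /\<^sub>R e)) \<partial>lborel)
    \<le> 2 * (\<integral>\<^sup>+ z. ennreal (gauss 1 z (0::'a)) * indicator {z. R \<le> norm z} z \<partial>lborel)
      + ennreal (R / e * R ^ DIM('a)) * emeasure lborel (ball (0::'a) 1) * (ennreal \<delta> + ennreal (\<delta> powr (1 - p)) * SWpp p \<mu> \<nu>)"
proof -
  note m = P_pD[OF \<mu>] and n = P_pD[OF \<nu>]
  interpret \<sigma>: prob_space "sphere_unif :: 'a measure" by (rule prob_space_sphere_unif)
  have [measurable_cong]: "sets (sphere_unif :: 'a measure) = sets borel" by (simp add: sphere_unif_def)
  define g where "g \<theta> = ennreal \<delta> + ennreal (\<delta> powr (1 - p)) * ray_sup p \<delta> \<mu> \<nu> y \<theta>" for \<theta>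
  have rs[measurable]: "ray_sup p \<delta> \<mu> \<nu> y \<in> borel_measurable borel"
    by (rule measurable_ray_sup) fact+
  have g[measurable]: "g \<in> borel_measurable borel" unfolding g_def by measurable
  have gauss1: "gauss 1 z 0 \<le> 1" for z :: 'a
  proof -
    have "1 / sqrt (2 * pi * 1\<^sup>2) \<le> 1"
      using pi_gt3 by (simp add: real_le_rsqrt)
    then have "(1 / sqrt (2 * pi * 1\<^sup>2)) ^ DIM('a) \<le> 1" by (intro power_le_one) auto
    with gauss_le[of 1 z 0] show ?thesis by linarith
  qed
  have [measurable]: "Measurable.pred borel (\<lambda>x::'a. x \<in> ball 0 R)"
    unfolding mem_ball by measurable
  have mg[measurable]: "(\<lambda>z. g (z /\<^sub>R norm z) * indicator (ball 0 R) z) \<in> borel_measurable borel"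
    by measurable
  have "(\<integral>\<^sup>+ z. ennreal (gauss 1 z 0 * cos_diff \<mu> \<nu> y (z /\<^sub>R e)) \<partial>lborel)
      \<le> (\<integral>\<^sup>+ z. 2 * (ennreal (gauss 1 z 0) * indicator {z. R \<le> norm z} z) + ennreal (R / e) * (g (z /\<^sub>R norm z) * indicator (ball 0 R) z) \<partial>lborel)"
  proof (rule nn_integral_mono)
    fix z :: 'a
    show "ennreal (gauss 1 z 0 * cos_diff \<mu> \<nu> y (z /\<^sub>R e))
      \<le> 2 * (ennreal (gauss 1 z 0) * indicator {z. R \<le> norm z} z) + ennreal (R / e) * (g (z /\<^sub>R norm z) * indicator (ball 0 R) z)"
    proof (cases "norm z < R")
      case True
      have "ennreal (gauss 1 z 0 * cos_diff \<mu> \<nu> y (z /\<^sub>R e)) = ennreal (gauss 1 z 0) * ennreal (cos_diff \<mu> \<nu> y (z /\<^sub>R e))"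
        by (simp add: ennreal_mult')
      also have "\<dots> \<le> 1 * (ennreal (norm z / e) * g (z /\<^sub>R norm z))"
        unfolding g_def
        by (intro mult_mono cos_diff_le_ray_sup m n \<delta> e) (auto simp: gauss1)
      also have "\<dots> \<le> 1 * (ennreal (R / e) * g (z /\<^sub>R norm z))"
        using True e by (intro mult_left_mono mult_right_mono ennreal_leI divide_right_mono) auto
      finally show ?thesis using True by simp
    next
      case False
      have "ennreal (gauss 1 z 0 * cos_diff \<mu> \<nu> y (z /\<^sub>R e)) \<le> ennreal (gauss 1 z 0 * 2)"
        by (intro ennreal_leI mult_left_mono cos_diff_le_2 m n) auto
      also have "\<dots> = 2 * ennreal (gauss 1 z 0)"
        by (simp add: ennreal_mult' mult.commute)
      finally show ?thesis using False by simp
    qed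
  qed
  also have "\<dots> = 2 * (\<integral>\<^sup>+ z. ennreal (gauss 1 z (0::'a)) * indicator {z. R \<le> norm z} z \<partial>lborel)
      + ennreal (R / e) * (\<integral>\<^sup>+ z. g (z /\<^sub>R norm z) * indicator (ball 0 R) z \<partial>lborel)"
    by (subst nn_integral_add) (auto simp: nn_integral_cmult)
  also have "(\<integral>\<^sup>+ z. g (z /\<^sub>R norm z) * indicator (ball 0 R) z \<partial>lborel)
      = ennreal (R ^ DIM('a)) * emeasure lborel (ball (0::'a) 1) * (\<integral>\<^sup>+ \<theta>. g \<theta> \<partial>sphere_unif)"
    by (rule nn_integral_ball_direction[OF g R])
  also have "(\<integral>\<^sup>+ \<theta>. g \<theta> \<partial>sphere_unif) = ennreal \<delta> + ennreal (\<delta> powr (1 - p)) * (\<integral>\<^sup>+ \<theta>. ray_sup p \<delta> \<mu> \<nu> y \<theta> \<partial>sphere_unif)"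
    unfolding g_def by (subst nn_integral_add) (auto simp: nn_integral_cmult \<sigma>.emeasure_space_1)
  also have "2 * (\<integral>\<^sup>+ z. ennreal (gauss 1 z (0::'a)) * indicator {z. R \<le> norm z} z \<partial>lborel)
      + ennreal (R / e) * (ennreal (R ^ DIM('a)) * emeasure lborel (ball (0::'a) 1) *
        (ennreal \<delta> + ennreal (\<delta> powr (1 - p)) * (\<integral>\<^sup>+ \<theta>. ray_sup p \<delta> \<mu> \<nu> y \<theta> \<partial>sphere_unif)))
    \<le> 2 * (\<integral>\<^sup>+ z. ennreal (gauss 1 z (0::'a)) * indicator {z. R \<le> norm z} z \<partial>lborel)
      + ennreal (R / e) * (ennreal (R ^ DIM('a)) * emeasure lborel (ball (0::'a) 1) *
        (ennreal \<delta> + ennreal (\<delta> powr (1 - p)) * SWpp p \<mu> \<nu>))"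
    by (intro add_left_mono mult_left_mono nn_integral_ray_sup_le p \<mu> \<nu> \<delta>) auto
  also have "\<dots> = 2 * (\<integral>\<^sup>+ z. ennreal (gauss 1 z (0::'a)) * indicator {z. R \<le> norm z} z \<partial>lborel)
      + ennreal (R / e * R ^ DIM('a)) * emeasure lborel (ball (0::'a) 1) * (ennreal \<delta> + ennreal (\<delta> powr (1 - p)) * SWpp p \<mu> \<nu>)"
  proof -
    have "ennreal (R / e * R ^ DIM('a)) = ennreal (R / e) * ennreal (R ^ DIM('a))"
      using R e by (intro ennreal_mult) auto
    then show ?thesis by (simp only: mult.assoc)
  qed
  finally show ?thesis .
qed

text \<open>The cosine is bounded and the Gaussian weight integrable, so Fubini averages the wave
  representation of the kernel over \<open>\<mu>\<close>.\<close>

lemma integral_gauss_eq: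
  fixes \<mu> :: "'a::euclidean_space measure"
  assumes \<mu>: "prob_space \<mu>" "sets \<mu> = sets borel" and e: "0 < e"
  shows "(\<integral>x. gauss e y x \<partial>\<mu>)
    = (1 / sqrt (2 * pi * e\<^sup>2)) ^ DIM('a) * (\<integral>z. gauss 1 z 0 * (\<integral>x. cos ((z /\<^sub>R e) \<bullet> (x - y)) \<partial>\<mu>) \<partial>lborel)"
    and "integrable lborel (\<lambda>z. gauss 1 z 0 * (\<integral>x. cos ((z /\<^sub>R e) \<bullet> (x - y)) \<partial>\<mu>))"
proof -
  note [measurable_cong] = \<mu>(2)
  interpret \<mu>: prob_space \<mu> by fact
  interpret P: pair_sigma_finite \<mu> "lborel :: 'a measure" ..
  let ?h = "\<lambda>x z. gauss 1 z 0 * cos ((z /\<^sub>R e) \<bullet> (x - y))"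
  have int: "integrable (\<mu> \<Otimes>\<^sub>M lborel) (case_prod ?h)"
  proof (rule integrableI_bounded)
    show "(\<lambda>(x, z). ?h x z) \<in> borel_measurable (\<mu> \<Otimes>\<^sub>M lborel)" by measurable
    have "(\<integral>\<^sup>+ w. ennreal (norm (case_prod ?h w)) \<partial>(\<mu> \<Otimes>\<^sub>M lborel)) \<le> (\<integral>\<^sup>+ w. ennreal (gauss 1 (snd w) 0) \<partial>(\<mu> \<Otimes>\<^sub>M (lborel :: 'a measure)))"
      by (intro nn_integral_mono ennreal_leI) (auto simp: abs_mult mult_left_le split: prod.split)
    also have "\<dots> = (\<integral>\<^sup>+ x. \<integral>\<^sup>+ z. ennreal (gauss 1 z (0::'a)) \<partial>lborel \<partial>\<mu>)"
      by (subst lborel.nn_integral_fst[symmetric]) auto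
    also have "\<dots> = 1" by (simp add: nn_integral_gauss \<mu>.emeasure_space_1)
    finally show "(\<integral>\<^sup>+ w. ennreal (norm (case_prod ?h w)) \<partial>(\<mu> \<Otimes>\<^sub>M lborel)) < \<infinity>"
      by (simp add: order_le_less_trans)
  qed
  have "(\<integral>x. gauss e y x \<partial>\<mu>) = (1 / sqrt (2 * pi * e\<^sup>2)) ^ DIM('a) * (\<integral>x. \<integral>z. ?h x z \<partial>lborel \<partial>\<mu>)"
    by (subst gauss_eq_integral_cos[OF e]) simp
  also have "(\<integral>x. \<integral>z. ?h x z \<partial>lborel \<partial>\<mu>) = (\<integral>z. \<integral>x. ?h x z \<partial>\<mu> \<partial>lborel)"
    by (rule P.Fubini_integral[OF int, symmetric])
  finally show "(\<integral>x. gauss e y x \<partial>\<mu>)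
    = (1 / sqrt (2 * pi * e\<^sup>2)) ^ DIM('a) * (\<integral>z. gauss 1 z 0 * (\<integral>x. cos ((z /\<^sub>R e) \<bullet> (x - y)) \<partial>\<mu>) \<partial>lborel)"
    by simp
  show "integrable lborel (\<lambda>z. gauss 1 z 0 * (\<integral>x. cos ((z /\<^sub>R e) \<bullet> (x - y)) \<partial>\<mu>))"
    using P.integrable_snd[OF int] by simp
qed

lemma ennreal_gauss_density_diff_le:
  fixes \<mu> \<nu> :: "'a::euclidean_space measure"
  assumes \<mu>: "prob_space \<mu>" "sets \<mu> = sets borel" and \<nu>: "prob_space \<nu>" "sets \<nu> = sets borel" and e: "0 < e"
  shows "ennreal ((\<integral>x. gauss e y x \<partial>\<nu>) - (\<integral>x. gauss e y x \<partial>\<mu>))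
    \<le> ennreal ((1 / sqrt (2 * pi * e\<^sup>2)) ^ DIM('a)) * (\<integral>\<^sup>+ z. ennreal (gauss 1 z 0 * cos_diff \<mu> \<nu> y (z /\<^sub>R e)) \<partial>lborel)"
proof -
  let ?c = "(1 / sqrt (2 * pi * e\<^sup>2)) ^ DIM('a)" and ?h = "\<lambda>z. gauss 1 z 0 * cos_diff \<mu> \<nu> y (z /\<^sub>R e)"
  have i: "integrable lborel ?h" and
    eq: "(\<integral>x. gauss e y x \<partial>\<nu>) - (\<integral>x. gauss e y x \<partial>\<mu>) = ?c * (\<integral>z. ?h z \<partial>lborel)"
    using integral_gauss_eq[OF \<mu> e, of y] integral_gauss_eq[OF \<nu> e, of y]
    by (auto simp: cos_diff_def right_diff_distrib)
  have "ennreal (\<integral>z. ?h z \<partial>lborel) \<le> (\<integral>\<^sup>+ z. ennreal (?h z) \<partial>lborel)"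
  proof -
    \<comment> \<open>The integrand is signed; replacing it by its positive part matches the
      truncation by \<open>ennreal\<close>.\<close>
    have "(\<integral>z. ?h z \<partial>lborel) \<le> (\<integral>z. max 0 (?h z) \<partial>lborel)"
      using i by (intro integral_mono) auto
    then have "ennreal (\<integral>z. ?h z \<partial>lborel) \<le> ennreal (\<integral>z. max 0 (?h z) \<partial>lborel)"
      by (rule ennreal_leI)
    also have "\<dots> = (\<integral>\<^sup>+ z. ennreal (max 0 (?h z)) \<partial>lborel)"
      using i by (intro nn_integral_eq_integral[symmetric]) auto
    finally show ?thesis by simp
  qed
  then show ?thesis unfolding eq by (simp add: ennreal_mult' mult_left_mono)
qed

section \<open>Convergence\<close>

lemma nn_integral_gauss_tail_tendsto_0:
  "(\<lambda>k. \<integral>\<^sup>+ z. ennreal (gauss 1 z (0::'a::euclidean_space)) * indicator {z. real k \<le> norm z} z \<partial>lborel) \<longlonglongrightarrow> 0"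
proof -
  have "(\<lambda>k. \<integral>\<^sup>+ z. ennreal (gauss 1 z (0::'a)) * indicator {z. real k \<le> norm z} z \<partial>lborel) \<longlonglongrightarrow> (\<integral>\<^sup>+ z. 0 \<partial>(lborel :: 'a measure))"
  proof (rule nn_integral_dominated_convergence[where w="\<lambda>z. ennreal (gauss 1 z 0)"])
    show "AE z in lborel. (\<lambda>k. ennreal (gauss 1 z (0::'a)) * indicator {z. real k \<le> norm z} z) \<longlonglongrightarrow> 0"
    proof (rule AE_I2)
      fix z :: 'a
      have "\<forall>\<^sub>F k in sequentially. norm z < real k"
        using filterlim_real_sequentially by (auto simp: filterlim_at_top_dense)
      then have "\<forall>\<^sub>F k in sequentially. ennreal (gauss 1 z 0) * indicator {z. real k \<le> norm z} z = 0"
        by eventually_elim auto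
      then show "(\<lambda>k. ennreal (gauss 1 z 0) * indicator {z. real k \<le> norm z} z) \<longlonglongrightarrow> 0"
        by (rule tendsto_eventually)
    qed
  qed (auto simp: nn_integral_gauss split: split_indicator)
  then show ?thesis by simp
qed

lemma ennreal_tendsto_0I:
  fixes f :: "nat \<Rightarrow> ennreal"
  assumes "\<And>\<eta>. 0 < \<eta> \<Longrightarrow> \<forall>\<^sub>F n in sequentially. f n < ennreal \<eta>"
  shows "f \<longlonglongrightarrow> 0"
proof (rule order_tendstoI)
  fix a :: ennreal assume "0 < a"
  then obtain x where x: "0 < x" "x < a" using dense by blast
  then obtain \<eta> where "x = ennreal \<eta>" by (cases x) auto
  with x have "0 < ennreal \<eta>" "ennreal \<eta> < a" by auto
  then show "\<forall>\<^sub>F n in sequentially. f n < a"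
    using assms[of \<eta>] by (auto elim: eventually_mono intro: order_less_trans)
qed auto

lemma tendsto_cmult_ennreal_0:
  fixes f :: "'b \<Rightarrow> ennreal"
  assumes "c \<noteq> top" "(f \<longlongrightarrow> 0) F"
  shows "((\<lambda>x. c * f x) \<longlongrightarrow> 0) F"
  using ennreal_tendsto_cmult[OF _ assms(2), of c] assms(1) by (simp add: less_top)

text \<open>The choices must be made in this order: \<open>R\<close> for the Gaussian tail, then
  \<open>\<delta>\<close>, whose coefficient \<open>B\<close> depends on \<open>R\<close>, and
  finally \<open>n\<close>, because \<open>\<delta> powr (1 - p)\<close> may be large but is then
  fixed in front of a null sequence.\<close>

lemma gauss_cos_diff_tendsto_0:
  fixes \<mu>s :: "nat \<Rightarrow> 'a::euclidean_space measure"
  assumes p: "1 \<le> p" and \<mu>s: "\<And>n. \<mu>s n \<in> P_p p" and \<nu>: "\<nu> \<in> P_p p" and e: "0 < e"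
    and SW: "(\<lambda>n. SWpp p (\<mu>s n) \<nu>) \<longlonglongrightarrow> 0"
  shows "(\<lambda>n. \<integral>\<^sup>+ z. ennreal (gauss 1 z 0 * cos_diff (\<mu>s n) \<nu> y (z /\<^sub>R e)) \<partial>lborel) \<longlonglongrightarrow> 0"
proof (rule ennreal_tendsto_0I)
  fix \<eta> :: real assume \<eta>: "0 < \<eta>"
  let ?G = "\<lambda>R. \<integral>\<^sup>+ z. ennreal (gauss 1 z (0::'a)) * indicator {z. R \<le> norm z} z \<partial>lborel"
  let ?b = "emeasure lborel (ball (0::'a) 1)"
  have b: "?b \<noteq> top" by (simp add: emeasure_ball)
  have "(\<lambda>k. 2 * ?G (real k)) \<longlonglongrightarrow> 0"
    by (rule tendsto_cmult_ennreal_0[OF _ nn_integral_gauss_tail_tendsto_0]) simp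
  then have "\<forall>\<^sub>F k in sequentially. 2 * ?G (real k) < ennreal (\<eta> / 2)"
    using \<eta> by (intro order_tendstoD) auto
  then have "\<forall>\<^sub>F k in sequentially. 0 < real k \<and> 2 * ?G (real k) < ennreal (\<eta> / 2)"
    using eventually_gt_at_top[of 0] by eventually_elim simp
  then obtain k where k: "0 < real k" "2 * ?G (real k) < ennreal (\<eta> / 2)"
    using eventually_happens'[OF sequentially_bot] by blast
  define R where "R = real k"
  have R: "0 < R" "2 * ?G R < ennreal (\<eta> / 2)" using k by (auto simp: R_def)
  define B where "B = ennreal (R / e * R ^ DIM('a)) * ?b"
  have B: "B \<noteq> top" using b by (simp add: B_def ennreal_mult_eq_top_iff)
  have "((\<lambda>\<delta>. B * ennreal \<delta>) \<longlongrightarrow> 0) (at_right 0)"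
    by (rule tendsto_cmult_ennreal_0[OF B]) (auto intro!: tendsto_eq_intros simp: ennreal_0[symmetric] simp del: ennreal_0)
  then have "\<forall>\<^sub>F \<delta> in at_right 0. B * ennreal \<delta> < ennreal (\<eta> / 2)"
    using \<eta> by (intro order_tendstoD) auto
  then have "\<forall>\<^sub>F \<delta>::real in at_right 0. 0 < \<delta> \<and> B * ennreal \<delta> < ennreal (\<eta> / 2)"
    using eventually_at_right_less[of 0] by eventually_elim simp
  then obtain \<delta> :: real where \<delta>: "0 < \<delta>" "B * ennreal \<delta> < ennreal (\<eta> / 2)"
    using eventually_happens'[OF trivial_limit_at_right_real] by blast
  have "(\<lambda>n. 2 * ?G R + B * (ennreal \<delta> + ennreal (\<delta> powr (1 - p)) * SWpp p (\<mu>s n) \<nu>)) \<longlonglongrightarrow> 2 * ?G R + B * (ennreal \<delta> + 0)"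
    using B by (intro tendsto_add tendsto_const ennreal_tendsto_cmult tendsto_cmult_ennreal_0[OF _ SW]) (auto simp: less_top)
  moreover have "2 * ?G R + B * (ennreal \<delta> + 0) < ennreal \<eta>"
  proof -
    have "2 * ?G R + B * ennreal \<delta> < ennreal (\<eta> / 2) + ennreal (\<eta> / 2)"
      using R(2) \<delta>(2) by (rule add_strict_mono)
    also have "\<dots> = ennreal \<eta>" using \<eta> by (subst ennreal_plus[symmetric]) auto
    finally show ?thesis by simp
  qed
  ultimately have "\<forall>\<^sub>F n in sequentially. 2 * ?G R + B * (ennreal \<delta> + ennreal (\<delta> powr (1 - p)) * SWpp p (\<mu>s n) \<nu>) < ennreal \<eta>"
    by (rule order_tendstoD(2))
  then show "\<forall>\<^sub>F n in sequentially. (\<integral>\<^sup>+ z. ennreal (gauss 1 z 0 * cos_diff (\<mu>s n) \<nu> y (z /\<^sub>R e)) \<partial>lborel) < ennreal \<eta>"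
  proof eventually_elim
    case (elim n)
    then show ?case
      using nn_integral_gauss_cos_diff_le[OF p \<mu>s \<nu> \<delta>(1) e R(1), of n y]
      unfolding B_def by (rule order_le_less_trans[rotated])
  qed
qed

section \<open>Smoothed densities and the mass they share\<close>

lemma nn_integral_gauss_eq_integral:
  fixes \<mu> :: "'a::euclidean_space measure"
  assumes "prob_space \<mu>" "sets \<mu> = sets borel"
  shows "(\<integral>\<^sup>+ x. ennreal (gauss e y x) \<partial>\<mu>) = ennreal (\<integral>x. gauss e y x \<partial>\<mu>)"
proof -
  note [measurable_cong] = assms(2)
  interpret prob_space \<mu> by fact
  have "integrable \<mu> (gauss e y)"
    by (rule integrable_const_bound[where B="(1 / sqrt (2 * pi * e\<^sup>2)) ^ DIM('a)"]) (auto simp: gauss_le)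
  then show ?thesis by (intro nn_integral_eq_integral) auto
qed

text \<open>Keeps the maximum of the two smoothed densities invertible in the smoothing
  coupling.\<close>

lemma nn_integral_gauss_pos:
  fixes \<mu> :: "'a::euclidean_space measure"
  assumes "prob_space \<mu>" "sets \<mu> = sets borel" "0 < e"
  shows "0 < (\<integral>\<^sup>+ x. ennreal (gauss e y x) \<partial>\<mu>)"
proof -
  note [measurable_cong] = assms(2)
  interpret prob_space \<mu> by fact
  have "(\<integral>\<^sup>+ x. ennreal (gauss e y x) \<partial>\<mu>) \<noteq> 0"
  proof
    assume "(\<integral>\<^sup>+ x. ennreal (gauss e y x) \<partial>\<mu>) = 0"
    then have "AE x in \<mu>. ennreal (gauss e y x) = 0"
      by (subst (asm) nn_integral_0_iff_AE) auto
    then have "AE x in \<mu>. False"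
      by eventually_elim (metis ennreal_eq_0_iff gauss_pos[OF assms(3)] not_le)
    then show False by simp
  qed
  then show ?thesis by (simp add: zero_less_iff_neq_zero)
qed

lemma nn_integral_gauss_density:
  fixes \<mu> :: "'a::euclidean_space measure"
  assumes \<mu>: "prob_space \<mu>" "sets \<mu> = sets borel" and e: "0 < e"
  shows "(\<integral>\<^sup>+ y. \<integral>\<^sup>+ x. ennreal (gauss e y x) \<partial>\<mu> \<partial>lborel) = 1"
proof -
  note [measurable_cong] = \<mu>(2)
  interpret prob_space \<mu> by fact
  interpret P: pair_sigma_finite "lborel :: 'a measure" \<mu> ..
  have "(\<integral>\<^sup>+ y. \<integral>\<^sup>+ x. ennreal (gauss e y x) \<partial>\<mu> \<partial>lborel) = (\<integral>\<^sup>+ x. \<integral>\<^sup>+ y. ennreal (gauss e y x) \<partial>lborel \<partial>\<mu>)"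
    by (rule P.Fubini'[symmetric]) measurable
  then show ?thesis by (simp add: nn_integral_gauss e emeasure_space_1)
qed

text \<open>Scheffe's argument: since the limit density \<open>b\<close> has mass 1, the missing
  overlap is the integral of the positive part of \<open>b - a k\<close>. That part is dominated by
  the fixed integrable \<open>b\<close>, so convergence at each single \<open>y\<close>
  suffices.\<close>

lemma gauss_density_overlap_tendsto:
  fixes \<mu>s :: "nat \<Rightarrow> 'a::euclidean_space measure"
  assumes p: "1 \<le> p" and \<mu>s: "\<And>n. \<mu>s n \<in> P_p p" and \<nu>: "\<nu> \<in> P_p p" and e: "0 < e"
    and SW: "(\<lambda>n. SWpp p (\<mu>s n) \<nu>) \<longlonglongrightarrow> 0"
  shows "(\<lambda>n. 1 - (\<integral>\<^sup>+ y. min (\<integral>\<^sup>+ x. ennreal (gauss e y x) \<partial>\<mu>s n) (\<integral>\<^sup>+ x. ennreal (gauss e y x) \<partial>\<nu>) \<partial>lborel)) \<longlonglongrightarrow> 0"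
proof -
  note m = P_pD[OF \<mu>s] and n = P_pD[OF \<nu>]
  define a where "a k y = (\<integral>\<^sup>+ x. ennreal (gauss e y x) \<partial>\<mu>s k)" for k y
  define b where "b y = (\<integral>\<^sup>+ x. ennreal (gauss e y x) \<partial>\<nu>)" for y
  have ma[measurable]: "a k \<in> borel_measurable borel" for k
  proof -
    note [measurable_cong] = m(2)[of k]
    interpret prob_space "\<mu>s k" by (rule m)
    show ?thesis unfolding a_def[abs_def] by measurable
  qed
  have mb[measurable]: "b \<in> borel_measurable borel"
  proof -
    note [measurable_cong] = n(2)
    interpret prob_space \<nu> by (rule n)
    show ?thesis unfolding b_def[abs_def] by measurable
  qed
  have b1: "(\<integral>\<^sup>+ y. b y \<partial>lborel) = 1"
    unfolding b_def by (rule nn_integral_gauss_density[OF n(1,2) e])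
  have b_fin: "b y < top" for y
    unfolding b_def nn_integral_gauss_eq_integral[OF n(1,2)] by simp
  have diff: "(\<lambda>k. b y - a k y) \<longlonglongrightarrow> 0" for y
  proof (rule tendsto_sandwich[OF _ _ tendsto_const])
    let ?c = "ennreal ((1 / sqrt (2 * pi * e\<^sup>2)) ^ DIM('a))"
    show "\<forall>\<^sub>F k in sequentially. b y - a k y \<le> ?c * (\<integral>\<^sup>+ z. ennreal (gauss 1 z 0 * cos_diff (\<mu>s k) \<nu> y (z /\<^sub>R e)) \<partial>lborel)"
    proof (rule always_eventually, rule allI)
      fix k
      have "b y - a k y = ennreal ((\<integral>x. gauss e y x \<partial>\<nu>) - (\<integral>x. gauss e y x \<partial>\<mu>s k))"
        unfolding a_def b_def nn_integral_gauss_eq_integral[OF n(1,2)] nn_integral_gauss_eq_integral[OF m(1,2)]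
        by (intro ennreal_minus integral_nonneg) auto
      also have "\<dots> \<le> ?c * (\<integral>\<^sup>+ z. ennreal (gauss 1 z 0 * cos_diff (\<mu>s k) \<nu> y (z /\<^sub>R e)) \<partial>lborel)"
        by (rule ennreal_gauss_density_diff_le[OF m(1,2) n(1,2) e])
      finally show "b y - a k y \<le> ?c * (\<integral>\<^sup>+ z. ennreal (gauss 1 z 0 * cos_diff (\<mu>s k) \<nu> y (z /\<^sub>R e)) \<partial>lborel)" .
    qed
    show "(\<lambda>k. ?c * (\<integral>\<^sup>+ z. ennreal (gauss 1 z 0 * cos_diff (\<mu>s k) \<nu> y (z /\<^sub>R e)) \<partial>lborel)) \<longlonglongrightarrow> 0"
      by (rule tendsto_cmult_ennreal_0[OF _ gauss_cos_diff_tendsto_0[OF p \<mu>s \<nu> e SW]]) simp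
  qed simp
  have "(\<lambda>k. \<integral>\<^sup>+ y. b y - a k y \<partial>lborel) \<longlonglongrightarrow> (\<integral>\<^sup>+ y. 0 \<partial>(lborel :: 'a measure))"
    by (rule nn_integral_dominated_convergence[where w=b]) (auto simp: b1 diff)
  moreover have "1 - (\<integral>\<^sup>+ y. min (a k y) (b y) \<partial>lborel) = (\<integral>\<^sup>+ y. b y - a k y \<partial>lborel)" for k
  proof -
    have le1: "(\<integral>\<^sup>+ y. min (a k y) (b y) \<partial>lborel) \<le> 1"
      unfolding b1[symmetric] by (intro nn_integral_mono) simp
    \<comment> \<open>Where \<open>a k y\<close> exceeds \<open>b y\<close>, both truncated
      differences are 0; this uses that \<open>b y\<close> is finite.\<close>
    have "b y - min (a k y) (b y) = b y - a k y" for y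
      by (cases "a k y \<le> b y") (auto simp: min_def diff_eq_0_ennreal b_fin)
    then have "(\<integral>\<^sup>+ y. b y - a k y \<partial>lborel) = (\<integral>\<^sup>+ y. b y - min (a k y) (b y) \<partial>lborel)" by simp
    also have "\<dots> = 1 - (\<integral>\<^sup>+ y. min (a k y) (b y) \<partial>lborel)"
      unfolding b1[symmetric] using le1 by (intro nn_integral_diff) (auto simp: top_unique)
    finally show ?thesis by simp
  qed
  ultimately show ?thesis unfolding a_def b_def by simp
qed

text \<open>Two successive limits of one bound: with no contribution from the sequence it becomes
  small for small \<open>e\<close> and large \<open>M\<close>; at fixed \<open>e\<close> and
  \<open>M\<close> that contribution then tends to 0.\<close>

lemma Wpp_tendsto_0:
  fixes \<mu>s :: "nat \<Rightarrow> 'a::euclidean_space measure"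
  assumes p: "1 \<le> p" and \<mu>s: "\<And>n. \<mu>s n \<in> P_p p" and \<nu>: "\<nu> \<in> P_p p"
    and SW: "(\<lambda>n. SWpp p (\<mu>s n) \<nu>) \<longlonglongrightarrow> 0"
  shows "(\<lambda>n. Wpp p (\<mu>s n) \<nu>) \<longlonglongrightarrow> 0"
proof (rule ennreal_tendsto_0I)
  fix \<eta> :: real assume \<eta>: "0 < \<eta>"
  note m = P_pD[OF \<mu>s] and n = P_pD[OF \<nu>]
  have p0: "0 \<le> p" "0 < p" using p by auto
  obtain c where c: "0 \<le> c" and moment: "\<And>e x. 0 < e \<Longrightarrow>
      (\<integral>\<^sup>+ y. ennreal (gauss e y x) * ennreal (dist x (y::'a) powr p) \<partial>lborel) \<le> ennreal (c * e powr p)"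
    by (rule gauss_moment[OF p0(1)]) (rule that)
  define K where "K = ennreal (4 ^ DIM('a) * 8 powr p)"
  define ov where "ov e k = 1 - (\<integral>\<^sup>+ y. min (\<integral>\<^sup>+ x. ennreal (gauss e y x) \<partial>\<mu>s k) (\<integral>\<^sup>+ x. ennreal (gauss e y x) \<partial>\<nu>) \<partial>lborel)" for e k
  \<comment> \<open>The arguments \<open>s\<close> and \<open>q\<close> stand for
    \<open>SWpp\<close> and the missing overlap, the two quantities that depend on the sequence. The
    radius \<open>4 * M\<close> is the one at which \<open>tail_moment_le\<close> applies.\<close>
  define bound where "bound e M s q = ennreal (2 powr p) * (2 * ennreal (c * e powr p) + 2 * ennreal ((4 * M) powr p) * q
      + K * (s + tail_moment p M \<nu>) + tail_moment p M \<nu>)" for e M s q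
  have le: "Wpp p (\<mu>s k) \<nu> \<le> bound e M (SWpp p (\<mu>s k) \<nu>) (ov e k)" if e: "0 < e" and M: "0 \<le> M" for e M k
  proof -
    have "Wpp p (\<mu>s k) \<nu> \<le> ennreal (2 powr p) * (2 * ennreal (c * e powr p) + 2 * ennreal ((4 * M) powr p) * ov e k
        + tail_moment p (4 * M) (\<mu>s k) + tail_moment p (4 * M) \<nu>)"
      unfolding ov_def
    proof (rule Wpp_le_smoothing[OF m(1,2) n(1,2), where \<kappa>="\<lambda>y x. ennreal (gauss e y x)"])
      show "(\<lambda>(y, x). ennreal (gauss e y x)) \<in> borel_measurable (borel \<Otimes>\<^sub>M borel)" by measurable
      show "(\<integral>\<^sup>+ x. ennreal (gauss e y x) \<partial>\<mu>s k) < \<infinity>" for y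
        by (simp add: nn_integral_gauss_eq_integral[OF m(1,2)])
      show "(\<integral>\<^sup>+ x. ennreal (gauss e y x) \<partial>\<nu>) < \<infinity>" for y
        by (simp add: nn_integral_gauss_eq_integral[OF n(1,2)])
    qed (use e M p0 in \<open>auto simp: nn_integral_gauss nn_integral_gauss_pos[OF m(1,2)] nn_integral_gauss_pos[OF n(1,2)] moment\<close>)
    also have "\<dots> \<le> bound e M (SWpp p (\<mu>s k) \<nu>) (ov e k)"
      unfolding bound_def K_def
    proof (intro mult_left_mono add_mono order_refl)
      show "tail_moment p (4 * M) (\<mu>s k) \<le> ennreal (4 ^ DIM('a) * 8 powr p) * (SWpp p (\<mu>s k) \<nu> + tail_moment p M \<nu>)"
        by (rule tail_moment_le[OF p0(2) \<mu>s \<nu> M])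
      show "tail_moment p (4 * M) \<nu> \<le> tail_moment p M \<nu>"
        using M by (intro nn_integral_mono mult_left_mono) (auto split: split_indicator)
    qed auto
    finally show ?thesis .
  qed
  \<comment> \<open>With \<open>q = 0\<close> the term carrying the growing factor
    \<open>(4 * M) powr p\<close> disappears. A single index drives \<open>e\<close> to 0 and
    \<open>M\<close> to infinity.\<close>
  have "(\<lambda>k. bound (1 / real (Suc k)) (real k) 0 0) \<longlonglongrightarrow> ennreal (2 powr p) * (2 * ennreal (c * 0 powr p) + 0 + K * (0 + 0) + 0)"
    unfolding bound_def mult_zero_right
  proof (intro ennreal_tendsto_cmult tendsto_add tendsto_const tendsto_ennrealI tendsto_mult_left tail_moment_tendsto_0 \<nu>)
    show "(\<lambda>k. (1 / real (Suc k)) powr p) \<longlonglongrightarrow> 0 powr p"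
      using p0 by (intro tendsto_powr' tendsto_const LIMSEQ_Suc[OF lim_1_over_n]) auto
  qed (auto simp: K_def)
  then have "(\<lambda>k. bound (1 / real (Suc k)) (real k) 0 0) \<longlonglongrightarrow> 0" using p0 by simp
  then have "\<forall>\<^sub>F k in sequentially. bound (1 / real (Suc k)) (real k) 0 0 < ennreal \<eta>"
    using \<eta> by (intro order_tendstoD) auto
  then obtain k where k: "bound (1 / real (Suc k)) (real k) 0 0 < ennreal \<eta>"
    using eventually_happens'[OF sequentially_bot] by blast
  define e where "e = 1 / real (Suc k)"
  have e: "0 < e" by (simp add: e_def)
  have "(\<lambda>j. bound e (real k) (SWpp p (\<mu>s j) \<nu>) (ov e j)) \<longlonglongrightarrow> bound e (real k) 0 0"
    unfolding bound_def ov_def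
    by (intro ennreal_tendsto_cmult tendsto_add tendsto_const SW gauss_density_overlap_tendsto[OF p \<mu>s \<nu> e SW])
      (auto simp: K_def ennreal_mult_less_top)
  then have "\<forall>\<^sub>F j in sequentially. bound e (real k) (SWpp p (\<mu>s j) \<nu>) (ov e j) < ennreal \<eta>"
    using k unfolding e_def by (rule order_tendstoD(2))
  then show "\<forall>\<^sub>F j in sequentially. Wpp p (\<mu>s j) \<nu> < ennreal \<eta>"
    by eventually_elim (rule order_le_less_trans[OF le[OF e]], auto)
qed

lemma SW_nonneg: "0 \<le> SW p \<mu> \<nu>"
  by (simp add: SW_def)

lemma Wasserstein_tendsto_0:
  fixes \<mu>s :: "nat \<Rightarrow> 'a::euclidean_space measure"
  assumes p: "1 \<le> p" and \<mu>s: "\<And>n. \<mu>s n \<in> P_p p" and \<nu>: "\<nu> \<in> P_p p"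
    and SW: "(\<lambda>n. SW p (\<mu>s n) \<nu>) \<longlonglongrightarrow> 0"
  shows "(\<lambda>n. Wasserstein p (\<mu>s n) \<nu>) \<longlonglongrightarrow> 0"
proof -
  have p0: "0 < p" using p by simp
  \<comment> \<open>Without finiteness, \<open>SW\<close> could be 0 while \<open>SWpp\<close> is
    infinite.\<close>
  have fin: "SWpp p (\<mu>s n) \<nu> < top" for n
    using nn_integral_Wasserstein_proj_le[OF p0 \<mu>s \<nu> prob_space_sphere_unif AE_sphere_unif]
    by (rule order_le_less_trans) simp
  have "(\<lambda>n. ennreal (SW p (\<mu>s n) \<nu> powr p)) \<longlonglongrightarrow> ennreal (0 powr p)"
    using p0 by (intro tendsto_ennrealI tendsto_powr' SW tendsto_const) (auto simp: SW_nonneg)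
  moreover have "ennreal (SW p (\<mu>s n) \<nu> powr p) = SWpp p (\<mu>s n) \<nu>" for n
    using p0 fin[of n] by (simp add: SW_def powr_powr)
  ultimately have "(\<lambda>n. SWpp p (\<mu>s n) \<nu>) \<longlonglongrightarrow> 0" using p0 by simp
  then have W: "(\<lambda>n. Wpp p (\<mu>s n) \<nu>) \<longlonglongrightarrow> 0" by (rule Wpp_tendsto_0[OF p \<mu>s \<nu>])
  have "(\<lambda>n. enn2real (Wpp p (\<mu>s n) \<nu>)) \<longlonglongrightarrow> 0"
    using tendsto_enn2real[of "\<lambda>n. Wpp p (\<mu>s n) \<nu>" 0 sequentially] W by simp
  then have "(\<lambda>n. enn2real (Wpp p (\<mu>s n) \<nu>) powr (1 / p)) \<longlonglongrightarrow> 0 powr (1 / p)"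
    using p0 by (intro tendsto_powr' tendsto_const) auto
  then show ?thesis by (simp add: Wasserstein_def)
qed

theorem theorem2:
  fixes \<mu> \<nu> :: "'a::euclidean_space measure" and p C :: real
  assumes "DIM('a) \<ge> 2" and "p \<ge> 1" and "admissible TYPE('a) C"
    and "\<mu> \<in> P_p p" and "\<nu> \<in> P_p p"
  shows "(DSW p C \<mu> \<nu> \<le> maxSW p \<mu> \<nu> \<and> maxSW p \<mu> \<nu> \<le> Wasserstein p \<mu> \<nu>) \<and>
         (C \<ge> 1 / real DIM('a) \<longrightarrow>
           DSW p C \<mu> \<nu> \<ge> (1 / real DIM('a)) powr (1 / p) * maxSW p \<mu> \<nu> \<and>
           (1 / real DIM('a)) powr (1 / p) * maxSW p \<mu> \<nu> \<ge> (1 / real DIM('a)) powr (1 / p) * SW p \<mu> \<nu>) \<and>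
         (C \<ge> 1 / real DIM('a) \<longrightarrow>
           (\<forall>(\<mu>s :: nat \<Rightarrow> 'a measure) \<mu>0. (\<forall>n. \<mu>s n \<in> P_p p) \<longrightarrow> \<mu>0 \<in> P_p p \<longrightarrow>
             (((\<lambda>n. DSW p C (\<mu>s n) \<mu>0) \<longlonglongrightarrow> 0) \<longleftrightarrow> ((\<lambda>n. SW p (\<mu>s n) \<mu>0) \<longlonglongrightarrow> 0)) \<and>
             (((\<lambda>n. SW p (\<mu>s n) \<mu>0) \<longlonglongrightarrow> 0) \<longleftrightarrow> ((\<lambda>n. maxSW p (\<mu>s n) \<mu>0) \<longlonglongrightarrow> 0)) \<and>
             (((\<lambda>n. maxSW p (\<mu>s n) \<mu>0) \<longlonglongrightarrow> 0) \<longleftrightarrow> ((\<lambda>n. Wasserstein p (\<mu>s n) \<mu>0) \<longlonglongrightarrow> 0))))"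
proof (intro conjI impI allI)
  have p: "0 < p" using assms(2) by simp
  show "DSW p C \<mu> \<nu> \<le> maxSW p \<mu> \<nu>" by (rule DSW_le_maxSW[OF p assms(4,5,3)])
  show "maxSW p \<mu> \<nu> \<le> Wasserstein p \<mu> \<nu>" by (rule maxSW_le_Wasserstein[OF p assms(4,5)])
  show "(1 / real DIM('a)) powr (1 / p) * maxSW p \<mu> \<nu> \<ge> (1 / real DIM('a)) powr (1 / p) * SW p \<mu> \<nu>"
    by (intro mult_left_mono SW_le_maxSW[OF p assms(4,5)]) simp
  assume C: "C \<ge> 1 / real DIM('a)"
  show "DSW p C \<mu> \<nu> \<ge> (1 / real DIM('a)) powr (1 / p) * maxSW p \<mu> \<nu>"
    by (rule maxSW_le_DSW[OF p assms(4,5) C])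
  fix \<mu>s :: "nat \<Rightarrow> 'a measure" and \<mu>0 :: "'a measure"
  assume "\<forall>n. \<mu>s n \<in> P_p p" and \<mu>0: "\<mu>0 \<in> P_p p"
  then have \<mu>s: "\<mu>s n \<in> P_p p" for n by simp
  let ?c = "(1 / real DIM('a)) powr (1 / p)"
  have squeeze: "f \<longlonglongrightarrow> 0" if "g \<longlonglongrightarrow> 0" "\<And>n. 0 \<le> f n" "\<And>n. f n \<le> g n" for f g :: "nat \<Rightarrow> real"
    by (rule tendsto_sandwich[OF _ _ tendsto_const that(1)]) (use that in auto)
  note max0 = maxSW_nonneg[OF p \<mu>s \<mu>0]
  \<comment> \<open>The implications run in a cycle from \<open>Wasserstein\<close> to
    \<open>maxSW\<close> to \<open>SW\<close> and back, while \<open>DSW\<close> is tied to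
    \<open>maxSW\<close> in both directions.\<close>
  have W_max: "(\<lambda>n. maxSW p (\<mu>s n) \<mu>0) \<longlonglongrightarrow> 0" if "(\<lambda>n. Wasserstein p (\<mu>s n) \<mu>0) \<longlonglongrightarrow> 0"
    by (rule squeeze[OF that max0 maxSW_le_Wasserstein[OF p \<mu>s \<mu>0]])
  have max_SW: "(\<lambda>n. SW p (\<mu>s n) \<mu>0) \<longlonglongrightarrow> 0" if "(\<lambda>n. maxSW p (\<mu>s n) \<mu>0) \<longlonglongrightarrow> 0"
    by (rule squeeze[OF that SW_nonneg SW_le_maxSW[OF p \<mu>s \<mu>0]])
  have SW_W: "(\<lambda>n. Wasserstein p (\<mu>s n) \<mu>0) \<longlonglongrightarrow> 0" if "(\<lambda>n. SW p (\<mu>s n) \<mu>0) \<longlonglongrightarrow> 0"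
    by (rule Wasserstein_tendsto_0[OF assms(2) \<mu>s \<mu>0 that])
  have max_D: "(\<lambda>n. DSW p C (\<mu>s n) \<mu>0) \<longlonglongrightarrow> 0" if "(\<lambda>n. maxSW p (\<mu>s n) \<mu>0) \<longlonglongrightarrow> 0"
  proof (rule squeeze[OF that _ DSW_le_maxSW[OF p \<mu>s \<mu>0 assms(3)]])
    \<comment> \<open>Read off from the lower bound by \<open>maxSW\<close>, which is
      nonnegative.\<close>
    show "0 \<le> DSW p C (\<mu>s n) \<mu>0" for n
      by (rule order_trans[OF _ maxSW_le_DSW[OF p \<mu>s \<mu>0 C]]) (simp add: max0)
  qed
  have D_max: "(\<lambda>n. maxSW p (\<mu>s n) \<mu>0) \<longlonglongrightarrow> 0" if D: "(\<lambda>n. DSW p C (\<mu>s n) \<mu>0) \<longlonglongrightarrow> 0"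
  proof (rule squeeze[OF _ max0])
    \<comment> \<open>The factor \<open>?c\<close> is positive and independent of \<open>n\<close>,
      so it can be divided out.\<close>
    show "(\<lambda>n. DSW p C (\<mu>s n) \<mu>0 / ?c) \<longlonglongrightarrow> 0" using tendsto_divide[OF D tendsto_const[of ?c]] by simp
    show "maxSW p (\<mu>s n) \<mu>0 \<le> DSW p C (\<mu>s n) \<mu>0 / ?c" for n
      using maxSW_le_DSW[OF p \<mu>s \<mu>0 C, of n] by (simp add: pos_le_divide_eq mult.commute)
  qed
  show "((\<lambda>n. DSW p C (\<mu>s n) \<mu>0) \<longlonglongrightarrow> 0) \<longleftrightarrow> ((\<lambda>n. SW p (\<mu>s n) \<mu>0) \<longlonglongrightarrow> 0)"
    using D_max max_SW SW_W W_max max_D by blast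
  show "((\<lambda>n. SW p (\<mu>s n) \<mu>0) \<longlonglongrightarrow> 0) \<longleftrightarrow> ((\<lambda>n. maxSW p (\<mu>s n) \<mu>0) \<longlonglongrightarrow> 0)"
    using max_SW SW_W W_max by blast
  show "((\<lambda>n. maxSW p (\<mu>s n) \<mu>0) \<longlonglongrightarrow> 0) \<longleftrightarrow> ((\<lambda>n. Wasserstein p (\<mu>s n) \<mu>0) \<longlonglongrightarrow> 0)"
    using max_SW SW_W W_max by blast
qed

end
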